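(* Let $K$ be a field of characteristic different from $2$, let $G$ be a group, and let $UT_n$ be endowed with a $G$-grading. Then there exists a homogeneous antiautomorphism of $UT_n$ if and only if the canonical involution $\circ$ of $UT_n$ is homogeneous. Any other homogeneous involution of $UT_n$ is a composition of $\circ$ with a graded automorphism of $UT_n$.
   Context: $UT_n$ is the associative $K$-algebra of $n\times n$ upper triangular matrices over $K$, with matrix units $E_{i,j}$ ($i\le j$). A $G$-grading $\Gamma$ on an algebra $A$ is a decomposition $A=\bigoplus_{g\in G}A_g$ into subspaces with $A_gA_h\subseteq A_{gh}$ for all $g,h\in G$; its support is $\mathrm{Supp}\,\Gamma=\{g\in G: A_g\neq\{0\}\}$. An antiautomorphism of an algebra $A$ is a bijective linear map $\varphi:A\to A$ with $\varphi(xy)=\varphi(y)\varphi(x)$ for all $x,y\in A$; an involution is an antiautomorphism with $\varphi^2=\mathrm{id}$. The canonical involution (reflection involution) $\circ$ on $UT_n$ is the linear map with $E_{i,j}^\circ=E_{n-j+1,n-i+1}$ for $1\le i\le j\le n$. An antiautomorphism (in particular an involution) $\varphi:A\to A$ of a graded algebra is homogeneous if there is a bijection $\theta:\mathrm{Supp}\,\Gamma\to\mathrm{Supp}\,\Gamma$ such that $\varphi(A_g)=A_{\theta(g)}$ for every $g\in\mathrm{Supp}\,\Gamma$. A graded automorphism is an algebra automorphism $\psi$ with $\psi(A_g)=A_g$ for all $g\in G$.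
   Formalization: The claim fails for gradings not adapted to the matrix units, so homogeneity of the canonical involution is taken for any isomorphic elementary grading (shown to exist); for the given grading, the last sentence assumes the canonical involution is homogeneous. *)

theory Defs
  imports
    "Jordan_Normal_Form.Matrix"
    "HOL-Algebra.Group"
    "HOL-Computational_Algebra.Computational_Algebra"
begin

text \<open>Matrix indices are 0-based: rows and columns run over \<open>0, ..., n - 1\<close>.
  Maps on the algebra are total functions on matrices of which only the restriction to
  \<open>UT n\<close> is relevant.\<close>

definition UT :: "nat \<Rightarrow> 'k::field mat set" where
  "UT n = {x \<in> carrier_mat n n. upper_triangular x}"

definition munit :: "nat \<Rightarrow> nat \<Rightarrow> nat \<Rightarrow> 'k::field mat" where
  "munit n i j = mat n n (\<lambda>(k, l). if k = i \<and> l = j then 1 else 0)"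

definition UT_subspace :: "nat \<Rightarrow> 'k::field mat set \<Rightarrow> bool" where
  "UT_subspace n W \<longleftrightarrow> W \<subseteq> UT n \<and> 0\<^sub>m n n \<in> W \<and>
     (\<forall>x\<in>W. \<forall>y\<in>W. x + y \<in> W) \<and> (\<forall>c. \<forall>x\<in>W. c \<cdot>\<^sub>m x \<in> W)"

text \<open>The last conjunct is the direct sum decomposition: \<open>c\<close> is the family of homogeneous
  components of \<open>x\<close>. The components are added entrywise, because square matrices of
  size \<open>n\<close> do not form a type of class \<open>comm_monoid_add\<close>; putting \<open>c\<close> equal to zero
  outside the group makes it unique as a function.\<close>

definition is_grading ::
  "nat \<Rightarrow> ('g, 'b) monoid_scheme \<Rightarrow> ('g \<Rightarrow> 'k::field mat set) \<Rightarrow> bool" where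
  "is_grading n G \<Gamma> \<longleftrightarrow>
     (\<forall>g\<in>carrier G. UT_subspace n (\<Gamma> g)) \<and>
     (\<forall>g\<in>carrier G. \<forall>h\<in>carrier G. \<forall>x\<in>\<Gamma> g. \<forall>y\<in>\<Gamma> h. x * y \<in> \<Gamma> (g \<otimes>\<^bsub>G\<^esub> h)) \<and>
     (\<forall>x\<in>UT n. \<exists>!c. (\<forall>g\<in>carrier G. c g \<in> \<Gamma> g) \<and> (\<forall>g. g \<notin> carrier G \<longrightarrow> c g = 0\<^sub>m n n) \<and>
        finite {g. c g \<noteq> 0\<^sub>m n n} \<and>
        x = mat n n (\<lambda>(i, j). \<Sum>g\<in>{g. c g \<noteq> 0\<^sub>m n n}. c g $$ (i, j)))"

definition Supp ::
  "nat \<Rightarrow> ('g, 'b) monoid_scheme \<Rightarrow> ('g \<Rightarrow> 'k::field mat set) \<Rightarrow> 'g set" where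
  "Supp n G \<Gamma> = {g \<in> carrier G. \<Gamma> g \<noteq> {0\<^sub>m n n}}"

definition UT_linear :: "nat \<Rightarrow> ('k::field mat \<Rightarrow> 'k mat) \<Rightarrow> bool" where
  "UT_linear n f \<longleftrightarrow> (\<forall>x\<in>UT n. \<forall>y\<in>UT n. f (x + y) = f x + f y) \<and>
     (\<forall>c. \<forall>x\<in>UT n. f (c \<cdot>\<^sub>m x) = c \<cdot>\<^sub>m f x)"

definition automorphism :: "nat \<Rightarrow> ('k::field mat \<Rightarrow> 'k mat) \<Rightarrow> bool" where
  "automorphism n f \<longleftrightarrow> bij_betw f (UT n) (UT n) \<and> UT_linear n f \<and>
     (\<forall>x\<in>UT n. \<forall>y\<in>UT n. f (x * y) = f x * f y)"

definition antiautomorphism :: "nat \<Rightarrow> ('k::field mat \<Rightarrow> 'k mat) \<Rightarrow> bool" where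
  "antiautomorphism n f \<longleftrightarrow> bij_betw f (UT n) (UT n) \<and> UT_linear n f \<and>
     (\<forall>x\<in>UT n. \<forall>y\<in>UT n. f (x * y) = f y * f x)"

definition involution :: "nat \<Rightarrow> ('k::field mat \<Rightarrow> 'k mat) \<Rightarrow> bool" where
  "involution n f \<longleftrightarrow> antiautomorphism n f \<and> (\<forall>x\<in>UT n. f (f x) = x)"

definition homogeneous ::
  "nat \<Rightarrow> ('g, 'b) monoid_scheme \<Rightarrow> ('g \<Rightarrow> 'k::field mat set) \<Rightarrow> ('k mat \<Rightarrow> 'k mat) \<Rightarrow> bool" where
  "homogeneous n G \<Gamma> f \<longleftrightarrow>
     (\<exists>\<theta>. bij_betw \<theta> (Supp n G \<Gamma>) (Supp n G \<Gamma>) \<and> (\<forall>g\<in>Supp n G \<Gamma>. f ` \<Gamma> g = \<Gamma> (\<theta> g)))"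

definition graded_automorphism ::
  "nat \<Rightarrow> ('g, 'b) monoid_scheme \<Rightarrow> ('g \<Rightarrow> 'k::field mat set) \<Rightarrow> ('k mat \<Rightarrow> 'k mat) \<Rightarrow> bool" where
  "graded_automorphism n G \<Gamma> f \<longleftrightarrow> automorphism n f \<and> (\<forall>g\<in>carrier G. f ` \<Gamma> g = \<Gamma> g)"

text \<open>The entry formula of the linear map given on matrix units by \<open>canon_munit\<close> below.\<close>

definition canon :: "nat \<Rightarrow> 'k::field mat \<Rightarrow> 'k mat" where
  "canon n x = mat n n (\<lambda>(i, j). x $$ (n - 1 - j, n - 1 - i))"

lemma canon_munit:
  assumes "i < n" "j < n"
  shows "canon n (munit n i j) = munit n (n - 1 - j) (n - 1 - i)"
  unfolding canon_def munit_def by (rule eq_matI) (use assms in auto)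

lemma canon_linear: "UT_linear n (canon n)"
  unfolding UT_linear_def canon_def UT_def by (auto intro!: eq_matI)

definition graded_isomorphic ::
  "nat \<Rightarrow> ('g, 'b) monoid_scheme \<Rightarrow> ('g \<Rightarrow> 'k::field mat set) \<Rightarrow> ('g \<Rightarrow> 'k mat set) \<Rightarrow> bool" where
  "graded_isomorphic n G \<Gamma> \<Gamma>' \<longleftrightarrow>
     (\<exists>\<alpha>. automorphism n \<alpha> \<and> (\<forall>g\<in>carrier G. \<alpha> ` \<Gamma> g = \<Gamma>' g))"

text \<open>For a grading, the inclusions below already determine every component: it is the
  span of the matrix units \<open>munit n i j\<close> with \<open>inv (\<gamma> i) \<otimes> \<gamma> j\<close> equal to its degree.\<close>

definition elementary ::
  "nat \<Rightarrow> ('g, 'b) monoid_scheme \<Rightarrow> ('g \<Rightarrow> 'k::field mat set) \<Rightarrow> bool" where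
  "elementary n G \<Gamma> \<longleftrightarrow> (\<exists>\<gamma>. (\<forall>i<n. \<gamma> i \<in> carrier G) \<and>
     (\<forall>i j. i \<le> j \<and> j < n \<longrightarrow> munit n i j \<in> \<Gamma> (inv\<^bsub>G\<^esub> (\<gamma> i) \<otimes>\<^bsub>G\<^esub> \<gamma> j)))"

end

theory Submission
  imports Defs "Jordan_Normal_Form.Determinant"
begin

text \<open>For an arbitrary grading, the strictly upper triangular matrices form a graded ideal. Hence so
  are the right ideals of matrices concentrated in the first row whose first \<open>j\<close> entries vanish, and
  conjugation by a homogeneous basis adapted to this flag makes the grading elementary. In an
  elementary grading every matrix unit is homogeneous. An antiautomorphism respects the powers of
  the radical and maps \<open>E\<^sub>i\<^sub>j\<close> to a matrix with non-zero entry at the reflected position; so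
  if it is homogeneous, the degree of the reflected matrix unit is the image of the degree of
  \<open>E\<^sub>i\<^sub>j\<close>, that is, the canonical involution permutes the components in the same way.\<close>

text \<open>The delicate point is that the radical is graded. For a non-abelian group a grading
  cannot be replaced by an action of characters, and the claim fails for subalgebras of
  \<open>UT n\<close>: in odd characteristic p the upper triangular Toeplitz matrices of size p form
  a copy of the group algebra of the cyclic group of order p, whose radical, the augmentation ideal,
  is not graded. The argument therefore has to use the matrix units of the full algebra. Row 0 is
  chosen for two reasons. It consists of the matrices annihilated by the radical from the left, so
  it inherits gradedness from the radical; and it is the faithful right module of row vectors, so
  the degrees of a homogeneous basis of it determine the degrees of all matrix positions.\<close>

subsection \<open>Triangular matrices\<close>

text \<open>For \<open>d > 0\<close> this is the \<open>d\<close>-th power of the radical, and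
  \<open>filt n 0\<close> is the whole algebra. Triangularity, vanishing diagonals and powers of the
  radical are thus handled by one filtration.\<close>

definition filt :: "nat \<Rightarrow> nat \<Rightarrow> 'k::field mat set" where
  "filt n d = {x \<in> carrier_mat n n. \<forall>i<n. \<forall>j<n. j < i + d \<longrightarrow> x $$ (i, j) = 0}"

lemma filt_carrier: "x \<in> filt n d \<Longrightarrow> x \<in> carrier_mat n n"
  by (simp add: filt_def)

lemma filtI:
  "x \<in> carrier_mat n n \<Longrightarrow> (\<And>i j. i < n \<Longrightarrow> j < n \<Longrightarrow> j < i + d \<Longrightarrow> x $$ (i, j) = 0) \<Longrightarrow> x \<in> filt n d"
  by (simp add: filt_def)

lemma filtD: "x \<in> filt n d \<Longrightarrow> i < n \<Longrightarrow> j < n \<Longrightarrow> j < i + d \<Longrightarrow> x $$ (i, j) = 0"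
  by (simp add: filt_def)

lemma UT_eq_filt: "UT n = filt n 0"
  by (auto simp: UT_def filt_def)

lemma UT_carrier: "x \<in> UT n \<Longrightarrow> x \<in> carrier_mat n n"
  by (simp add: UT_def)

lemma UT_entry: "x \<in> UT n \<Longrightarrow> i < n \<Longrightarrow> j < i \<Longrightarrow> x $$ (i, j) = 0"
  by (auto simp: UT_def)

lemma mult_entry:
  assumes "x \<in> carrier_mat n n" "y \<in> carrier_mat n n" "i < n" "j < n"
  shows "(x * y) $$ (i, j) = (\<Sum>k<n. x $$ (i, k) * y $$ (k, j))"
  using assms by (auto simp: scalar_prod_def lessThan_atLeast0 intro!: sum.cong)

lemma filt_mult:
  assumes x: "x \<in> filt n a" and y: "y \<in> filt n b"
  shows "x * y \<in> filt n (a + b)"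
proof (rule filtI)
  show "x * y \<in> carrier_mat n n"
    using filt_carrier[OF x] filt_carrier[OF y] by simp
  fix i j assume ij: "i < n" "j < n" "j < i + (a + b)"
  have "x $$ (i, k) * y $$ (k, j) = 0" if "k < n" for k
    using filtD[OF x ij(1) that] filtD[OF y that ij(2)] ij(3) by (cases "k < i + a") auto
  then show "(x * y) $$ (i, j) = 0"
    unfolding mult_entry[OF filt_carrier[OF x] filt_carrier[OF y] ij(1,2)] by (intro sum.neutral) auto
qed

text \<open>Leading superdiagonals multiply as in the associated graded algebra: \<open>x\<close>
  kills the terms with \<open>k < i + a\<close>, and \<open>y\<close> those with
  \<open>k > i + a\<close>. For \<open>a = b = 0\<close> this makes each diagonal entry a
  multiplicative functional.\<close>

lemma filt_mult_entry:
  assumes x: "x \<in> filt n a" and y: "y \<in> filt n b" and i: "i + a + b < n"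
  shows "(x * y) $$ (i, i + a + b) = x $$ (i, i + a) * y $$ (i + a, i + a + b)"
proof -
  have "x $$ (i, k) * y $$ (k, i + a + b) = 0" if "k < n" "k \<noteq> i + a" for k
    using filtD[OF x _ that(1), of i] filtD[OF y that(1), of "i + a + b"] that i
    by (cases "k < i + a") auto
  then have "(\<Sum>k<n. x $$ (i, k) * y $$ (k, i + a + b))
      = (\<Sum>k\<in>{i + a}. x $$ (i, k) * y $$ (k, i + a + b))"
    using i by (intro sum.mono_neutral_right) auto
  then show ?thesis
    using i by (simp add: mult_entry[OF filt_carrier[OF x] filt_carrier[OF y]])
qed

lemma UT_mult: "x \<in> UT n \<Longrightarrow> y \<in> UT n \<Longrightarrow> x * y \<in> UT n"
  using filt_mult[of x n 0 y 0] by (simp add: UT_eq_filt)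

lemma UT_mult_diag:
  "x \<in> UT n \<Longrightarrow> y \<in> UT n \<Longrightarrow> i < n \<Longrightarrow> (x * y) $$ (i, i) = x $$ (i, i) * y $$ (i, i)"
  using filt_mult_entry[of x n 0 y 0 i] by (simp add: UT_eq_filt)

lemma UT_add: "x \<in> UT n \<Longrightarrow> y \<in> UT n \<Longrightarrow> x + y \<in> UT n"
  by (auto simp: UT_eq_filt filt_def)

lemma UT_smult: "x \<in> UT n \<Longrightarrow> c \<cdot>\<^sub>m x \<in> UT n"
  by (auto simp: UT_eq_filt filt_def)

lemma UT_zero: "0\<^sub>m n n \<in> UT n"
  by (auto simp: UT_def)

lemma munit_carrier: "munit n i j \<in> carrier_mat n n"
  by (simp add: munit_def)

lemma munit_entry:
  "a < n \<Longrightarrow> b < n \<Longrightarrow> munit n i j $$ (a, b) = (if a = i \<and> b = j then 1 else 0)"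
  by (simp add: munit_def)

lemma munit_UT: "i \<le> j \<Longrightarrow> munit n i j \<in> UT n"
  by (auto simp: UT_eq_filt munit_entry munit_carrier intro!: filtI)

lemma munit_mult_entry:
  assumes "x \<in> carrier_mat n n" "j < n" "a < n" "b < n"
  shows "(munit n i j * x) $$ (a, b) = (if a = i then x $$ (j, b) else 0)"
proof -
  have "(munit n i j * x) $$ (a, b) = (\<Sum>k<n. if k = j then (if a = i then x $$ (j, b) else 0) else 0)"
    unfolding mult_entry[OF munit_carrier assms(1,3,4)]
    using assms by (intro sum.cong) (auto simp: munit_entry)
  then show ?thesis using assms by (simp add: sum.delta)
qed

lemma mult_munit_entry:
  assumes "x \<in> carrier_mat n n" "i < n" "a < n" "b < n"
  shows "(x * munit n i j) $$ (a, b) = (if b = j then x $$ (a, i) else 0)"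
proof -
  have "(x * munit n i j) $$ (a, b) = (\<Sum>k<n. if k = i then (if b = j then x $$ (a, i) else 0) else 0)"
    unfolding mult_entry[OF assms(1) munit_carrier assms(3,4)]
    using assms by (intro sum.cong) (auto simp: munit_entry)
  then show ?thesis using assms by (simp add: sum.delta)
qed

lemma mat_eqI:
  "x \<in> carrier_mat n n \<Longrightarrow> y \<in> carrier_mat n n
    \<Longrightarrow> (\<And>i j. i < n \<Longrightarrow> j < n \<Longrightarrow> x $$ (i, j) = y $$ (i, j)) \<Longrightarrow> x = y"
  by (intro eq_matI) auto

lemma munit_mult_munit: "j < n \<Longrightarrow> munit n i j * munit n j k = munit n i k"
  by (rule mat_eqI[of _ n])
    (auto simp: munit_mult_entry[OF munit_carrier] munit_entry munit_carrier
      intro!: mult_carrier_mat[OF munit_carrier] simp del: index_mult_mat)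

lemma munit_neq_zero: "i < n \<Longrightarrow> j < n \<Longrightarrow> munit n i j \<noteq> (0\<^sub>m n n :: 'k::field mat)"
  using munit_entry[of i n j i j, where ?'a = 'k] by auto

section \<open>Finite sums of square matrices\<close>

definition msum :: "nat \<Rightarrow> 's set \<Rightarrow> ('s \<Rightarrow> 'k::field mat) \<Rightarrow> 'k mat" where
  "msum n S c = mat n n (\<lambda>(i, j). \<Sum>s\<in>S. c s $$ (i, j))"

lemma msum_carrier: "msum n S c \<in> carrier_mat n n"
  by (simp add: msum_def)

lemma msum_entry: "i < n \<Longrightarrow> j < n \<Longrightarrow> msum n S c $$ (i, j) = (\<Sum>s\<in>S. c s $$ (i, j))"
  by (simp add: msum_def)

lemma msum_empty: "msum n {} c = 0\<^sub>m n n"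
  by (rule mat_eqI[of _ n]) (auto simp: msum_carrier msum_entry)

lemma msum_insert:
  assumes "finite S" "s \<notin> S" "c s \<in> carrier_mat n n"
  shows "msum n (insert s S) c = c s + msum n S c"
  using assms msum_carrier[of n S c]
  by (intro mat_eqI[of _ n]) (auto simp: msum_carrier msum_entry[of _ n] carrier_matD[OF msum_carrier])

lemma msum_mono_neutral:
  assumes "finite T" "S \<subseteq> T" "\<And>t. t \<in> T - S \<Longrightarrow> c t = 0\<^sub>m n n"
  shows "msum n T c = msum n S c"
  using assms by (intro mat_eqI[of _ n] msum_carrier) (auto simp: msum_entry intro!: sum.mono_neutral_right)

lemma UT_subspace_UT: "UT_subspace n (UT n)"
  by (auto simp: UT_subspace_def UT_zero UT_add UT_smult)

lemma msum_in_subspace: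
  assumes "UT_subspace n W" "finite S" "\<And>s. s \<in> S \<Longrightarrow> c s \<in> W"
  shows "msum n S c \<in> W"
  using assms(2,3)
proof (induction rule: finite_induct)
  case empty
  then show ?case using assms(1) by (simp add: msum_empty UT_subspace_def)
next
  case (insert s S)
  then have "c s \<in> carrier_mat n n"
    using assms(1) by (auto simp: UT_subspace_def UT_def)
  with insert assms(1) show ?case by (simp add: msum_insert UT_subspace_def)
qed

lemma UT_linear_zero:
  assumes "UT_linear n f" "f ` UT n \<subseteq> UT n"
  shows "f (0\<^sub>m n n) = 0\<^sub>m n n"
proof -
  have "f (0 \<cdot>\<^sub>m 0\<^sub>m n n) = 0 \<cdot>\<^sub>m f (0\<^sub>m n n)"
    using assms(1) UT_zero[of n] unfolding UT_linear_def by blast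
  moreover have "f (0\<^sub>m n n) \<in> carrier_mat n n"
    using assms(2) UT_zero UT_carrier by blast
  then have "0 \<cdot>\<^sub>m f (0\<^sub>m n n) = 0\<^sub>m n n"
    by (intro mat_eqI[of _ n]) auto
  ultimately show ?thesis by simp
qed

lemma UT_linear_msum:
  assumes f: "UT_linear n f" "f ` UT n \<subseteq> UT n" and "finite S" "\<And>s. s \<in> S \<Longrightarrow> c s \<in> UT n"
  shows "f (msum n S c) = msum n S (\<lambda>s. f (c s))"
  using assms(3,4)
proof (induction rule: finite_induct)
  case empty
  then show ?case by (simp add: msum_empty UT_linear_zero[OF f])
next
  case (insert s S)
  have S: "msum n S c \<in> UT n"
    using insert by (intro msum_in_subspace[OF UT_subspace_UT]) auto
  have s: "c s \<in> UT n" "c s \<in> carrier_mat n n" "f (c s) \<in> carrier_mat n n"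
    using insert.prems f(2) UT_carrier by blast+
  show ?case
    using f(1) insert S s by (simp add: msum_insert UT_linear_def)
qed

lemma UT_linear_mult_left: "y \<in> UT n \<Longrightarrow> UT_linear n ((*) y)"
  unfolding UT_linear_def
  by (auto intro!: mult_add_distrib_mat mult_smult_distrib dest!: UT_carrier)

lemma UT_linear_mult_right: "y \<in> UT n \<Longrightarrow> UT_linear n (\<lambda>x. x * y)"
  unfolding UT_linear_def
  by (auto intro!: add_mult_distrib_mat mult_smult_assoc_mat dest!: UT_carrier)

subsection \<open>Homogeneous components\<close>

definition decomp ::
  "nat \<Rightarrow> ('g, 'b) monoid_scheme \<Rightarrow> ('g \<Rightarrow> 'k::field mat set) \<Rightarrow> 'k mat \<Rightarrow> ('g \<Rightarrow> 'k mat) \<Rightarrow> bool" where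
  "decomp n G \<Gamma> x c \<longleftrightarrow> (\<forall>g\<in>carrier G. c g \<in> \<Gamma> g) \<and> (\<forall>g. g \<notin> carrier G \<longrightarrow> c g = 0\<^sub>m n n) \<and>
     finite {g. c g \<noteq> 0\<^sub>m n n} \<and> x = msum n {g. c g \<noteq> 0\<^sub>m n n} c"

lemma is_grading_iff:
  "is_grading n G \<Gamma> \<longleftrightarrow>
     (\<forall>g\<in>carrier G. UT_subspace n (\<Gamma> g)) \<and>
     (\<forall>g\<in>carrier G. \<forall>h\<in>carrier G. \<forall>x\<in>\<Gamma> g. \<forall>y\<in>\<Gamma> h. x * y \<in> \<Gamma> (g \<otimes>\<^bsub>G\<^esub> h)) \<and>
     (\<forall>x\<in>UT n. \<exists>!c. decomp n G \<Gamma> x c)"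
  unfolding is_grading_def decomp_def msum_def ..

locale UT_grading = group G for G :: "('g, 'b) monoid_scheme" (structure) +
  fixes n :: nat and \<Gamma> :: "'g \<Rightarrow> 'k::field mat set"
  assumes grading: "is_grading n G \<Gamma>"
begin

lemma subspace: "g \<in> carrier G \<Longrightarrow> UT_subspace n (\<Gamma> g)"
  using grading by (simp add: is_grading_def)

lemma \<Gamma>_UT: "g \<in> carrier G \<Longrightarrow> x \<in> \<Gamma> g \<Longrightarrow> x \<in> UT n"
  using subspace[of g] by (auto simp: UT_subspace_def)

lemma \<Gamma>_zero: "g \<in> carrier G \<Longrightarrow> 0\<^sub>m n n \<in> \<Gamma> g"
  using subspace by (auto simp: UT_subspace_def)

lemma \<Gamma>_smult: "g \<in> carrier G \<Longrightarrow> x \<in> \<Gamma> g \<Longrightarrow> c \<cdot>\<^sub>m x \<in> \<Gamma> g"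
  using subspace by (auto simp: UT_subspace_def)

lemma \<Gamma>_mult:
  "g \<in> carrier G \<Longrightarrow> h \<in> carrier G \<Longrightarrow> x \<in> \<Gamma> g \<Longrightarrow> y \<in> \<Gamma> h \<Longrightarrow> x * y \<in> \<Gamma> (g \<otimes> h)"
  using grading by (simp add: is_grading_def)

definition comp :: "'k mat \<Rightarrow> 'g \<Rightarrow> 'k mat" where
  "comp x = (THE c. decomp n G \<Gamma> x c)"

definition supp :: "'k mat \<Rightarrow> 'g set" where
  "supp x = {g. comp x g \<noteq> 0\<^sub>m n n}"

lemma ex1_decomp: "x \<in> UT n \<Longrightarrow> \<exists>!c. decomp n G \<Gamma> x c"
  using grading unfolding is_grading_iff by blast

lemma decomp_comp: "x \<in> UT n \<Longrightarrow> decomp n G \<Gamma> x (comp x)"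
  unfolding comp_def by (rule theI'[OF ex1_decomp])

lemma comp_unique: "x \<in> UT n \<Longrightarrow> decomp n G \<Gamma> x c \<Longrightarrow> comp x = c"
  using ex1_decomp decomp_comp by blast

lemma comp_in: "x \<in> UT n \<Longrightarrow> g \<in> carrier G \<Longrightarrow> comp x g \<in> \<Gamma> g"
  using decomp_comp unfolding decomp_def by blast

lemma comp_UT: "x \<in> UT n \<Longrightarrow> comp x g \<in> UT n"
  using decomp_comp[of x] \<Gamma>_UT UT_zero unfolding decomp_def by (cases "g \<in> carrier G") force+

lemma supp_finite: "x \<in> UT n \<Longrightarrow> finite (supp x)"
  using decomp_comp unfolding decomp_def supp_def by blast

lemma supp_carrier: "x \<in> UT n \<Longrightarrow> supp x \<subseteq> carrier G"
  using decomp_comp unfolding decomp_def supp_def by blast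

lemma comp_zero: "g \<notin> supp x \<Longrightarrow> comp x g = 0\<^sub>m n n"
  by (simp add: supp_def)

lemma msum_comp: "x \<in> UT n \<Longrightarrow> msum n (supp x) (comp x) = x"
  using decomp_comp[of x] unfolding decomp_def supp_def by auto

lemma comp_eqI:
  assumes x: "x \<in> UT n" and S: "finite S" "S \<subseteq> carrier G" and c: "\<And>g. g \<in> S \<Longrightarrow> c g \<in> \<Gamma> g"
    and sum: "x = msum n S c"
  shows "comp x g = (if g \<in> S then c g else 0\<^sub>m n n)"
proof -
  \<comment> \<open>The family \<open>c\<close> is arbitrary outside \<open>S\<close> and may vanish
    inside; cutting it off with zeros gives the normal form that \<open>decomp\<close>
    demands.\<close>
  let ?c = "\<lambda>g. if g \<in> S then c g else 0\<^sub>m n n"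
  have "msum n S c = msum n S ?c"
    by (intro mat_eqI[of _ n] msum_carrier) (auto simp: msum_entry intro!: sum.cong)
  also have "\<dots> = msum n {g. ?c g \<noteq> 0\<^sub>m n n} ?c"
    using S by (intro msum_mono_neutral) (auto split: if_splits)
  finally have "x = msum n {g. ?c g \<noteq> 0\<^sub>m n n} ?c"
    using sum by simp
  moreover have "finite {g. ?c g \<noteq> 0\<^sub>m n n}"
    using S(1) by (rule rev_finite_subset) auto
  ultimately have "decomp n G \<Gamma> x ?c"
    unfolding decomp_def using S c \<Gamma>_zero by auto
  then show ?thesis
    using comp_unique[OF x] by simp
qed

lemma comp_homogeneous:
  assumes "g \<in> carrier G" "x \<in> \<Gamma> g"
  shows "comp x h = (if h = g then x else 0\<^sub>m n n)"
proof -
  have x: "x \<in> UT n" using assms \<Gamma>_UT by blast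
  have "x = msum n {g} (\<lambda>_. x)"
    using UT_carrier[OF x] by (intro mat_eqI[of _ n]) (auto simp: msum_carrier msum_entry)
  then show ?thesis
    using comp_eqI[OF x, of "{g}" "\<lambda>_. x" h] assms by auto
qed

lemma homogeneous_unique:
  assumes "g \<in> carrier G" "h \<in> carrier G" "x \<in> \<Gamma> g" "x \<in> \<Gamma> h" "x \<noteq> 0\<^sub>m n n"
  shows "g = h"
  using comp_homogeneous[OF assms(1,3), of g] comp_homogeneous[OF assms(2,4), of g] assms(5)
  by (auto split: if_splits)

lemma comp_linear: "UT_linear n (\<lambda>x. comp x g)"
  unfolding UT_linear_def
proof (intro conjI ballI allI)
  fix x y :: "'k mat" assume xy: "x \<in> UT n" "y \<in> UT n"
  \<comment> \<open>The two supports differ, so both decompositions are padded with zero components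
    to a common index set.\<close>
  let ?S = "supp x \<union> supp y"
  have 1: "msum n ?S (comp x) = x" "msum n ?S (comp y) = y"
    using msum_mono_neutral[of ?S "supp x" "comp x" n] msum_mono_neutral[of ?S "supp y" "comp y" n]
    by (simp_all add: supp_finite xy msum_comp comp_zero)
  have car: "comp x h \<in> carrier_mat n n" "comp y h \<in> carrier_mat n n" for h
    using comp_UT xy UT_carrier by blast+
  have "msum n ?S (\<lambda>g. comp x g + comp y g) = msum n ?S (comp x) + msum n ?S (comp y)"
    using car carrier_matD[OF car(1)] carrier_matD[OF car(2)]
    by (intro mat_eqI[of _ n])
      (auto simp: msum_carrier msum_entry sum.distrib carrier_matD[OF msum_carrier])
  then have sum: "x + y = msum n ?S (\<lambda>g. comp x g + comp y g)"
    using 1 by simp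
  have "comp x h + comp y h \<in> \<Gamma> h" if "h \<in> ?S" for h
    using that subspace[of h] comp_in supp_carrier xy unfolding UT_subspace_def by blast
  then have "comp (x + y) g = (if g \<in> ?S then comp x g + comp y g else 0\<^sub>m n n)"
    using supp_carrier supp_finite xy by (intro comp_eqI[OF UT_add[OF xy] _ _ _ sum]) auto
  then show "comp (x + y) g = comp x g + comp y g"
    by (auto simp: comp_zero)
next
  fix a and x :: "'k mat" assume x: "x \<in> UT n"
  have car: "comp x h \<in> carrier_mat n n" for h
    using comp_UT x UT_carrier by blast
  have "msum n (supp x) (\<lambda>g. a \<cdot>\<^sub>m comp x g) = a \<cdot>\<^sub>m msum n (supp x) (comp x)"
    using car carrier_matD[OF car]
    by (intro mat_eqI[of _ n])
      (auto simp: msum_carrier msum_entry sum_distrib_left carrier_matD[OF msum_carrier])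
  then have sum: "a \<cdot>\<^sub>m x = msum n (supp x) (\<lambda>g. a \<cdot>\<^sub>m comp x g)"
    using msum_comp[OF x] by simp
  have "a \<cdot>\<^sub>m comp x h \<in> \<Gamma> h" if "h \<in> supp x" for h
    using that \<Gamma>_smult comp_in supp_carrier x by blast
  then have "comp (a \<cdot>\<^sub>m x) g = (if g \<in> supp x then a \<cdot>\<^sub>m comp x g else 0\<^sub>m n n)"
    using supp_carrier supp_finite x by (intro comp_eqI[OF UT_smult[OF x] _ _ _ sum]) auto
  then show "comp (a \<cdot>\<^sub>m x) g = a \<cdot>\<^sub>m comp x g"
    by (auto simp: comp_zero)
qed

lemma comp_msum:
  "finite S \<Longrightarrow> (\<And>s. s \<in> S \<Longrightarrow> c s \<in> UT n) \<Longrightarrow> comp (msum n S c) g = msum n S (\<lambda>s. comp (c s) g)"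
  using UT_linear_msum[OF comp_linear, of g S c] comp_UT by blast

lemma msum_comp_mult:
  assumes "x \<in> UT n" "y \<in> UT n"
  shows "msum n (supp x) (\<lambda>k. comp x k * y) = x * y"
    and "msum n (supp x) (\<lambda>k. y * comp x k) = y * x"
  using UT_linear_msum[OF UT_linear_mult_right, of y n "supp x" "comp x"]
    UT_linear_msum[OF UT_linear_mult_left, of y n "supp x" "comp x"]
  by (simp_all add: assms UT_mult comp_UT supp_finite msum_comp image_subset_iff)

text \<open>Left multiplication by a homogeneous element shifts degrees by \<open>h\<close>. By
  cancellation in the group this shift is injective, so only the component of degree
  \<open>g\<close> reaches \<open>h \<otimes> g\<close>.\<close>

lemma comp_mult_left:
  assumes h: "h \<in> carrier G" "y \<in> \<Gamma> h" and g: "g \<in> carrier G" and x: "x \<in> UT n"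
  shows "comp (y * x) (h \<otimes> g) = y * comp x g"
proof -
  have y: "y \<in> UT n" using h \<Gamma>_UT by blast
  have c: "comp (y * comp x k) (h \<otimes> g) = (if k = g then y * comp x g else 0\<^sub>m n n)"
    if "k \<in> supp x" for k
    using that comp_homogeneous[OF _ \<Gamma>_mult[OF h(1) _ h(2) comp_in[OF x, of k]], of "h \<otimes> g"]
      supp_carrier[OF x] h g by auto
  have "comp (y * x) (h \<otimes> g) = msum n (supp x) (\<lambda>k. comp (y * comp x k) (h \<otimes> g))"
    unfolding msum_comp_mult(2)[OF x y, symmetric]
    by (intro comp_msum supp_finite x UT_mult[OF y] comp_UT)
  also have "\<dots> = msum n (supp x) (\<lambda>k. if k = g then y * comp x g else 0\<^sub>m n n)"
    using c by (auto simp: msum_def intro!: cong_mat sum.cong)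
  also have "\<dots> = y * comp x g"
  proof (rule mat_eqI[of _ n])
    show "y * comp x g \<in> carrier_mat n n"
      using UT_mult[OF y comp_UT[OF x]] UT_carrier by blast
    fix i j assume ij: "i < n" "j < n"
    have "y * comp x g = 0\<^sub>m n n" if "g \<notin> supp x"
      using that UT_carrier[OF y] by (simp add: comp_zero)
    then show "msum n (supp x) (\<lambda>k. if k = g then y * comp x g else 0\<^sub>m n n) $$ (i, j) = (y * comp x g) $$ (i, j)"
      using ij supp_finite[OF x] by (auto simp: msum_entry if_distrib[of "\<lambda>z. z $$ _"] sum.delta cong: if_cong simp del: index_mult_mat(1))
  qed (rule msum_carrier)
  finally show ?thesis .
qed

lemma comp_mult_right:
  assumes h: "h \<in> carrier G" "y \<in> \<Gamma> h" and g: "g \<in> carrier G" and x: "x \<in> UT n"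
  shows "comp (x * y) (g \<otimes> h) = comp x g * y"
proof -
  have y: "y \<in> UT n" using h \<Gamma>_UT by blast
  have c: "comp (comp x k * y) (g \<otimes> h) = (if k = g then comp x g * y else 0\<^sub>m n n)"
    if "k \<in> supp x" for k
    using that comp_homogeneous[OF _ \<Gamma>_mult[OF _ h(1) comp_in[OF x, of k] h(2)], of "g \<otimes> h"]
      supp_carrier[OF x] h g by auto
  have "comp (x * y) (g \<otimes> h) = msum n (supp x) (\<lambda>k. comp (comp x k * y) (g \<otimes> h))"
    unfolding msum_comp_mult(1)[OF x y, symmetric]
    by (intro comp_msum supp_finite x UT_mult[OF _ y] comp_UT)
  also have "\<dots> = msum n (supp x) (\<lambda>k. if k = g then comp x g * y else 0\<^sub>m n n)"
    using c by (auto simp: msum_def intro!: cong_mat sum.cong)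
  also have "\<dots> = comp x g * y"
  proof (rule mat_eqI[of _ n])
    show "comp x g * y \<in> carrier_mat n n"
      using UT_mult[OF comp_UT[OF x] y] UT_carrier by blast
    fix i j assume ij: "i < n" "j < n"
    have "comp x g * y = 0\<^sub>m n n" if "g \<notin> supp x"
      using that UT_carrier[OF y] by (simp add: comp_zero)
    then show "msum n (supp x) (\<lambda>k. if k = g then comp x g * y else 0\<^sub>m n n) $$ (i, j) = (comp x g * y) $$ (i, j)"
      using ij supp_finite[OF x] by (auto simp: msum_entry if_distrib[of "\<lambda>z. z $$ _"] sum.delta cong: if_cong simp del: index_mult_mat(1))
  qed (rule msum_carrier)
  finally show ?thesis .
qed

text \<open>The convolution formula; the order of the factors in \<open>inv a \<otimes> m\<close>
  matters because the group need not be commutative.\<close>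

lemma comp_mult:
  assumes x: "x \<in> UT n" and y: "y \<in> UT n" and m: "m \<in> carrier G"
  shows "comp (x * y) m = msum n (supp x) (\<lambda>a. comp x a * comp y (inv a \<otimes> m))"
proof -
  have "comp (x * y) m = msum n (supp x) (\<lambda>a. comp (comp x a * y) m)"
    unfolding msum_comp_mult(1)[OF x y, symmetric]
    by (intro comp_msum supp_finite x UT_mult[OF _ y] comp_UT)
  also have "\<dots> = msum n (supp x) (\<lambda>a. comp x a * comp y (inv a \<otimes> m))"
  proof -
    have "comp (comp x a * y) m = comp x a * comp y (inv a \<otimes> m)" if "a \<in> supp x" for a
    proof -
      have a: "a \<in> carrier G" using that supp_carrier[OF x] by blast
      then show ?thesis
        using comp_mult_left[OF a comp_in[OF x a], of "inv a \<otimes> m" y] y m by (simp add: m_assoc[symmetric])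
    qed
    then show ?thesis
      by (auto simp: msum_def intro!: cong_mat sum.cong)
  qed
  finally show ?thesis .
qed

end

subsection \<open>The radical is graded\<close>

text \<open>Below, \<open>e g j\<close> is the \<open>j\<close>-th diagonal entry of the degree \<open>g\<close> component of the
  idempotent \<open>munit n i i\<close>. The degrees \<open>g\<close> with \<open>e g i \<noteq> 0\<close> form a finite subgroup; diagonals
  multiply commutatively, which makes up for the non-commutativity of the group.\<close>

lemma (in group) shift_swap:
  fixes e :: "'a \<Rightarrow> 's \<Rightarrow> 'k::field" and x :: "'s \<Rightarrow> 'k"
  assumes fin: "finite {g \<in> carrier G. e g i \<noteq> 0}" and s0: "s0 \<in> carrier G" "e s0 i \<noteq> 0"
    and e: "\<And>g k j. g \<in> carrier G \<Longrightarrow> k \<in> carrier G \<Longrightarrow> j \<in> N \<Longrightarrow> e k j * e g j = e k i * e (k \<otimes> g) j"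
    and x: "\<And>g j. g \<in> carrier G \<Longrightarrow> j \<in> N \<Longrightarrow> x j * e g j = x i * e (h \<otimes> g) j"
    and i: "i \<in> N" and h: "h \<in> carrier G" and g: "g \<in> carrier G" and j: "j \<in> N"
  shows "x i * e (h \<otimes> g) j = x i * e (g \<otimes> h) j"
proof (cases "x i = 0")
  case False
  define S where "S = {g \<in> carrier G. e g i \<noteq> 0}"
  have inv_h: "e (h \<otimes> k) i = e k i" if "k \<in> carrier G" for k
    using x[OF that i] False by simp
  have inv_S: "e (s \<otimes> k) i = e k i" if "s \<in> S" "k \<in> carrier G" for s k
    using e[OF that(2) _ i, of s] that(1) by (simp add: S_def)
  \<comment> \<open>\<open>S\<close> is finite and stable under the injective left translation by
    \<open>s\<close>, so the translation permutes \<open>S\<close>. This supplies the neutral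
    element and inverses.\<close>
  have surj: "\<exists>k\<in>S. s \<otimes> k = t" if "s \<in> S" "t \<in> S" for s t
  proof -
    have "(\<otimes>) s ` S \<subseteq> S" using that inv_S by (auto simp: S_def)
    moreover have "inj_on ((\<otimes>) s) S" using that by (auto simp: inj_on_def S_def)
    ultimately have "(\<otimes>) s ` S = S"
      by (rule endo_inj_surj[OF fin[folded S_def]])
    then show ?thesis using that(2) by (metis imageE)
  qed
  have k0S: "s0 \<in> S" using s0 by (simp add: S_def)
  obtain k1 where "k1 \<in> S" "s0 \<otimes> k1 = s0" using surj[OF k0S k0S] by blast
  then have one: "\<one> \<in> S" using s0 by (simp add: S_def)
  have hS: "h \<in> S" using inv_h[of \<one>] one h by (simp add: S_def)
  have const: "e s i = e \<one> i" if "s \<in> S" for s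
    using inv_S[OF that, of \<one>] that by (simp add: S_def)
  \<comment> \<open>With both degrees equal to \<open>k\<close>, the identity \<open>e\<close> turns
    the square of \<open>e k j\<close> into a multiple of \<open>e k i\<close>, which is
    zero.\<close>
  have outside: "e k j = 0" if "k \<in> carrier G" "k \<notin> S" for k
    using e[OF that(1) that(1) j] that by (simp add: S_def)
  show ?thesis
  proof (cases "g \<in> S")
    case True
    \<comment> \<open>The commuting product \<open>e h j * e g j\<close> is expanded in both orders;
      the factors \<open>e h i\<close> and \<open>e g i\<close> then cancel, being the same non-zero
      constant.\<close>
    have "e h i * e (h \<otimes> g) j = e g i * e (g \<otimes> h) j"
      using e[OF g h j] e[OF h g j] by (simp add: mult.commute)
    then show ?thesis using const[OF hS] const[OF True] one by (simp add: S_def)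
  next
    case notS: False
    have "g \<otimes> h \<notin> S"
    proof
      assume "g \<otimes> h \<in> S"
      obtain h' where h': "h' \<in> S" "h \<otimes> h' = \<one>" using surj[OF hS one] by blast
      have "g \<otimes> h \<otimes> h' = g" using g h h' by (simp add: m_assoc S_def)
      then have "e g i = e h' i" using inv_S[OF \<open>g \<otimes> h \<in> S\<close>, of h'] h' by (simp add: S_def)
      then show False using notS h' g by (simp add: S_def)
    qed
    moreover have "h \<otimes> g \<notin> S"
      using inv_h[OF g] notS g by (simp add: S_def)
    ultimately show ?thesis using outside g h by simp
  qed
qed simp

context UT_grading
begin

lemma supp_entry_sum:
  "x \<in> UT n \<Longrightarrow> i < n \<Longrightarrow> j < n \<Longrightarrow> (\<Sum>g\<in>supp x. comp x g $$ (i, j)) = x $$ (i, j)"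
  using msum_entry[of i n j "supp x" "comp x"] by (simp add: msum_comp)

text \<open>Call \<open>x\<close> negligible if all its homogeneous components have zero diagonal. By induction,
  \<open>munit n l j\<close> is negligible for \<open>l < i\<close>, so left multiplication by \<open>x\<close> scales \<open>munit n i i\<close> by
  \<open>x $$ (i, i)\<close> up to negligible terms. This makes \<open>munit n i i\<close> central up to negligible terms,
  and then \<open>munit n i j = munit n i i * munit n i j\<close> is negligible as well.\<close>

lemma comp_munit_diag:
  assumes "i < j" "j < n" "g \<in> carrier G" "k < n"
  shows "comp (munit n i j) g $$ (k, k) = 0"
  using assms
proof (induction i arbitrary: j g k rule: less_induct)
  case (less i)
  define E :: "'k mat" where "E = munit n i i"
  define e where "e g k = comp E g $$ (k, k)" for g k
  have i: "i < n" using less.prems by simp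
  have E: "E \<in> UT n" unfolding E_def by (rule munit_UT) simp
  \<comment> \<open>Only column \<open>i\<close> of \<open>x\<close> survives in
    \<open>x * E\<close>. Its entries above the diagonal are coefficients of
    \<open>munit n l i\<close> with \<open>l < i\<close>, which contribute nothing by the induction
    hypothesis.\<close>
  have left: "comp (x * E) g $$ (k, k) = x $$ (i, i) * e g k"
    if x: "x \<in> UT n" and g: "g \<in> carrier G" and k: "k < n" for x g k
  proof -
    have UT: "x $$ (l, i) \<cdot>\<^sub>m munit n l i \<in> UT n" if "l \<in> {..i}" for l
      using that by (intro UT_smult munit_UT) simp
    have "x * E = msum n {..i} (\<lambda>l. x $$ (l, i) \<cdot>\<^sub>m munit n l i)"
    proof (rule mat_eqI[of _ n])
      show "x * E \<in> carrier_mat n n" using UT_mult[OF x E] by (rule UT_carrier)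
      fix a b assume ab: "a < n" "b < n"
      have "(\<Sum>l\<le>i. (x $$ (l, i) \<cdot>\<^sub>m munit n l i) $$ (a, b))
          = (\<Sum>l\<le>i. if l = a then (if b = i then x $$ (a, i) else 0) else 0)"
        using ab by (intro sum.cong) (auto simp: munit_entry carrier_matD[OF munit_carrier])
      also have "\<dots> = (if b = i then x $$ (a, i) else 0)"
        using UT_entry[OF x ab(1), of i] by (auto simp: sum.delta)
      finally show "(x * E) $$ (a, b) = msum n {..i} (\<lambda>l. x $$ (l, i) \<cdot>\<^sub>m munit n l i) $$ (a, b)"
        unfolding E_def mult_munit_entry[OF UT_carrier[OF x] i ab] msum_entry[OF ab] by simp
    qed (rule msum_carrier)
    then have "comp (x * E) g = msum n {..i} (\<lambda>l. comp (x $$ (l, i) \<cdot>\<^sub>m munit n l i) g)"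
      using comp_msum[OF finite_atMost UT, where g = g] by simp
    then have "comp (x * E) g $$ (k, k) = (\<Sum>l\<le>i. comp (x $$ (l, i) \<cdot>\<^sub>m munit n l i) g $$ (k, k))"
      using k by (simp add: msum_entry)
    also have "\<dots> = (\<Sum>l\<le>i. x $$ (l, i) * comp (munit n l i) g $$ (k, k))"
    proof (rule sum.cong[OF refl])
      fix l assume "l \<in> {..i}"
      then have l: "(munit n l i :: 'k mat) \<in> UT n" by (intro munit_UT) simp
      then have "comp (x $$ (l, i) \<cdot>\<^sub>m munit n l i) g = x $$ (l, i) \<cdot>\<^sub>m comp (munit n l i) g"
        using comp_linear[of g] unfolding UT_linear_def by blast
      then show "comp (x $$ (l, i) \<cdot>\<^sub>m munit n l i) g $$ (k, k) = x $$ (l, i) * comp (munit n l i) g $$ (k, k)"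
        using k carrier_matD[OF UT_carrier[OF comp_UT[OF l]]] by simp
    qed
    also have "\<dots> = (\<Sum>l\<in>{i}. x $$ (l, i) * comp (munit n l i) g $$ (k, k))"
      using less.IH g k i by (intro sum.mono_neutral_right) auto
    finally show ?thesis by (simp add: e_def E_def)
  qed
  \<comment> \<open>The same component of \<open>x * E\<close> is evaluated twice: by
    \<open>left\<close>, and by pulling the homogeneous factor \<open>x\<close> out of the
    component.\<close>
  have hom: "x $$ (k, k) * e g k = x $$ (i, i) * e (h \<otimes> g) k"
    if "h \<in> carrier G" "x \<in> \<Gamma> h" "g \<in> carrier G" "k < n" for x h g k
  proof -
    have x: "x \<in> UT n" using that \<Gamma>_UT by blast
    have "comp (x * E) (h \<otimes> g) = x * comp E g"
      using comp_mult_left that E by blast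
    then have "comp (x * E) (h \<otimes> g) $$ (k, k) = x $$ (k, k) * e g k"
      using UT_mult_diag[OF x comp_UT[OF E] that(4)] by (simp add: e_def)
    then show ?thesis using left[OF x, of "h \<otimes> g" k] that by simp
  qed
  have "(\<Sum>g\<in>supp E. e g i) = 1"
    unfolding e_def supp_entry_sum[OF E i i] using i by (simp add: E_def munit_entry)
  then obtain s0 where s0: "s0 \<in> supp E" "e s0 i \<noteq> 0"
    by (metis sum.neutral zero_neq_one)
  have fin: "finite {g \<in> carrier G. e g i \<noteq> 0}"
  proof (rule finite_subset[OF _ supp_finite[OF E]], rule subsetI)
    fix g assume "g \<in> {g \<in> carrier G. e g i \<noteq> 0}"
    then show "g \<in> supp E" using comp_zero[of g E] i by (cases "g \<in> supp E") (auto simp: e_def)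
  qed
  \<comment> \<open>The identity on \<open>e\<close> required by \<open>shift_swap\<close> is
    \<open>hom\<close> applied to the homogeneous components of \<open>E\<close> itself.\<close>
  have swap: "x $$ (i, i) * e (h \<otimes> g) k = x $$ (i, i) * e (g \<otimes> h) k"
    if "h \<in> carrier G" "x \<in> \<Gamma> h" "g \<in> carrier G" "k < n" for x h g k
  proof (rule shift_swap[where e = e and i = i and N = "{..<n}" and x = "\<lambda>k. x $$ (k, k)", OF fin _ s0(2)])
    show "e k j * e g j = e k i * e (k \<otimes> g) j"
      if "g \<in> carrier G" "k \<in> carrier G" "j \<in> {..<n}" for g k j
      using hom[OF that(2) comp_in[OF E that(2)] that(1)] that(3) by (simp add: e_def)
    show "x $$ (j, j) * e g j = x $$ (i, i) * e (h \<otimes> g) j" if "g \<in> carrier G" "j \<in> {..<n}" for g j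
      using hom[OF \<open>h \<in> carrier G\<close> \<open>x \<in> \<Gamma> h\<close> that(1)] that(2) by simp
  qed (use fin s0 supp_carrier[OF E] that i in auto)
  have right: "comp (E * x) g $$ (k, k) = x $$ (i, i) * e g k"
    if "h \<in> carrier G" "x \<in> \<Gamma> h" "g \<in> carrier G" "k < n" for x h g k
  proof -
    let ?g = "g \<otimes> inv h"
    have x: "x \<in> UT n" using that \<Gamma>_UT by blast
    have g: "?g \<in> carrier G" "?g \<otimes> h = g" using that by (auto simp: m_assoc)
    have "comp (E * x) g = comp E ?g * x"
      using comp_mult_right[OF that(1,2) g(1) E] g(2) by simp
    then have "comp (E * x) g $$ (k, k) = x $$ (k, k) * e ?g k"
      using UT_mult_diag[OF comp_UT[OF E] x that(4)] by (simp add: e_def mult.commute)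
    \<comment> \<open>\<open>hom\<close> produces the degree \<open>h \<otimes> ?g\<close>, whereas
      \<open>g\<close> is \<open>?g \<otimes> h\<close>; this is the one place where the order of
      degrees has to be exchanged.\<close>
    also have "\<dots> = x $$ (i, i) * e g k"
      using hom[OF that(1,2) g(1) that(4)] swap[OF that(1,2) g(1) that(4)] g(2) by simp
    finally show ?thesis .
  qed
  define F :: "'k mat" where "F = munit n i j"
  have F: "F \<in> UT n" unfolding F_def using less.prems by (intro munit_UT) simp
  \<comment> \<open>Applying \<open>right\<close> to every component of \<open>F\<close> reduces the
    diagonal of \<open>comp F g\<close> to a multiple of \<open>F $$ (i, i)\<close>, which is zero
    because \<open>i < j\<close>.\<close>
  have "F = E * F"
    unfolding E_def F_def using i by (simp add: munit_mult_munit)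
  also have "\<dots> = msum n (supp F) (\<lambda>h. E * comp F h)"
    using msum_comp_mult(2)[OF F E] by simp
  finally have "comp F g = msum n (supp F) (\<lambda>h. comp (E * comp F h) g)"
    using comp_msum[OF supp_finite[OF F], of "\<lambda>h. E * comp F h" g] UT_mult[OF E comp_UT[OF F]] by simp
  then have "comp F g $$ (k, k) = (\<Sum>h\<in>supp F. comp (E * comp F h) g $$ (k, k))"
    using less.prems by (simp add: msum_entry)
  also have "\<dots> = (\<Sum>h\<in>supp F. comp F h $$ (i, i) * e g k)"
    using less.prems right comp_in[OF F] supp_carrier[OF F] by (intro sum.cong) blast+
  also have "\<dots> = F $$ (i, i) * e g k"
    by (simp add: sum_distrib_right[symmetric] supp_entry_sum[OF F i i])
  also have "\<dots> = 0"
    using less.prems i by (simp add: F_def munit_entry)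
  finally show ?case by (simp add: F_def)
qed

lemma comp_munit_filt:
  assumes "i < j" "j < n"
  shows "comp (munit n i j) g \<in> filt n 1"
proof (rule filtI)
  have UT: "comp (munit n i j) g \<in> UT n"
    using assms by (intro comp_UT munit_UT) simp
  then show "comp (munit n i j) g \<in> carrier_mat n n" by (rule UT_carrier)
  fix a b assume "a < n" "b < n" "b < a + 1"
  moreover have "comp (munit n i j) g = 0\<^sub>m n n" if "g \<notin> carrier G"
    using that supp_carrier[OF munit_UT[of i j n]] assms by (intro comp_zero) auto
  ultimately show "comp (munit n i j) g $$ (a, b) = 0"
    using UT_entry[OF UT] comp_munit_diag[OF assms]
    by (cases "a = b"; cases "g \<in> carrier G") auto
qed

end

subsection \<open>Every grading is isomorphic to an elementary one\<close>

text \<open>The determinant gives an inverse among all square matrices. Below the diagonal, entry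
  \<open>(i, j)\<close> of \<open>Q * P = 1\<close> reduces to
  \<open>Q $$ (i, j) * P $$ (j, j)\<close>: terms with \<open>k < j\<close> vanish by induction on
  the column and terms with \<open>k > j\<close> by triangularity of \<open>P\<close>.\<close>

lemma UT_inverse:
  assumes P: "P \<in> UT n" and diag: "\<And>i. i < n \<Longrightarrow> P $$ (i, i) \<noteq> 0"
  obtains Q where "Q \<in> UT n" "P * Q = 1\<^sub>m n" "Q * P = 1\<^sub>m n"
proof -
  have car: "P \<in> carrier_mat n n" using P by (rule UT_carrier)
  have "det P = prod_list (diag_mat P)"
    using P by (intro det_upper_triangular[of _ n]) (auto simp: UT_def)
  also have "\<dots> \<noteq> 0"
    using car diag by (auto simp: prod_list_zero_iff diag_mat_def)
  finally have "P \<in> Units (ring_mat TYPE('a) n undefined)"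
    using car by (intro det_non_zero_imp_unit)
  then obtain Q where Q: "Q \<in> carrier_mat n n" "P * Q = 1\<^sub>m n" "Q * P = 1\<^sub>m n"
    unfolding Units_def ring_mat_def by auto
  have "Q $$ (i, j) = 0" if "i < n" "j < i" for i j
    using that(2)
  proof (induction j rule: less_induct)
    case (less j)
    have "0 = (Q * P) $$ (i, j)" using Q less.prems that(1) by simp
    also have "\<dots> = (\<Sum>k<n. Q $$ (i, k) * P $$ (k, j))"
      using less.prems that(1) by (intro mult_entry[OF Q(1) car]) auto
    also have "\<dots> = (\<Sum>k\<in>{j}. Q $$ (i, k) * P $$ (k, j))"
    proof (rule sum.mono_neutral_right)
      show "\<forall>k\<in>{..<n} - {j}. Q $$ (i, k) * P $$ (k, j) = 0"
      proof
        fix k assume "k \<in> {..<n} - {j}"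
        then show "Q $$ (i, k) * P $$ (k, j) = 0"
          using less UT_entry[OF P, of k j] by (cases "k < j") auto
      qed
    qed (use less.prems that(1) in auto)
    finally show ?case using diag[of j] less.prems that(1) by simp
  qed
  then have "Q \<in> UT n" using Q(1) by (auto simp: UT_def)
  with Q show thesis by (intro that)
qed

lemma conjugation_automorphism:
  assumes "P \<in> UT n" "Q \<in> UT n" "P * Q = 1\<^sub>m n" "Q * P = 1\<^sub>m n"
  shows "automorphism n (\<lambda>x. P * x * Q)"
proof -
  have car: "P \<in> carrier_mat n n" "Q \<in> carrier_mat n n" using assms UT_carrier by blast+
  have cancel: "P * (Q * x * P) * Q = x" "Q * (P * x * Q) * P = x" if "x \<in> carrier_mat n n" for x
  proof -
    have "P * (Q * x * P) * Q = (P * Q) * x * (P * Q)"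
      using car that by (simp add: assoc_mult_mat[of _ n n _ n _ n] del: assms)
    then show "P * (Q * x * P) * Q = x" using assms that by simp
    have "Q * (P * x * Q) * P = (Q * P) * x * (Q * P)"
      using car that by (simp add: assoc_mult_mat[of _ n n _ n _ n])
    then show "Q * (P * x * Q) * P = x" using assms that by simp
  qed
  have "bij_betw (\<lambda>x. P * x * Q) (UT n) (UT n)"
    using assms cancel[OF UT_carrier]
    by (intro bij_betw_byWitness[where f' = "\<lambda>x. Q * x * P"])
      (simp_all add: UT_mult image_subset_iff)
  moreover have "UT_linear n (\<lambda>x. P * x * Q)"
    using UT_linear_mult_left[OF assms(1)] UT_linear_mult_right[OF assms(2)] UT_mult[OF assms(1)]
    unfolding UT_linear_def by simp
  moreover have "P * (x * y) * Q = (P * x * Q) * (P * y * Q)" if "x \<in> UT n" "y \<in> UT n" for x y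
  proof -
    have xy: "x \<in> carrier_mat n n" "y \<in> carrier_mat n n" using that UT_carrier by blast+
    have "(P * x * Q) * (P * y * Q) = P * x * (Q * P) * (y * Q)"
      using car xy by (simp add: assoc_mult_mat[of _ n n _ n _ n])
    also have "\<dots> = P * (x * y) * Q"
      using car xy assms by (simp add: assoc_mult_mat[of _ n n _ n _ n])
    finally show ?thesis by simp
  qed
  ultimately show ?thesis unfolding automorphism_def by blast
qed

context UT_grading
begin

text \<open>Each component of \<open>munit n 0 i\<close> with \<open>i > 0\<close> lies in the
  radical, hence has zero column 0 and annihilates \<open>munit n 0 0\<close> from the left. It then
  annihilates every component of that idempotent; summing over the components of
  \<open>munit n 0 i\<close> shows that row \<open>i\<close> of each of these is zero.\<close>

lemma comp_first_idempotent:
  assumes "i < n" "j < n" "i \<noteq> 0"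
  shows "comp (munit n 0 0) g $$ (i, j) = 0"
proof (cases "g \<in> carrier G")
  case True
  define E :: "'k mat" where "E = munit n 0 0"
  define F :: "'k mat" where "F = munit n 0 i"
  have E: "E \<in> UT n" and F: "F \<in> UT n" unfolding E_def F_def by (auto intro: munit_UT)
  have zero: "comp F h * comp E g = 0\<^sub>m n n" if h: "h \<in> supp F" for h
  proof -
    have Z: "comp F h \<in> filt n 1" unfolding F_def using assms by (intro comp_munit_filt) auto
    have "comp F h * E = 0\<^sub>m n n"
    proof (rule mat_eqI[of _ n])
      fix a b assume ab: "a < n" "b < n"
      then show "(comp F h * E) $$ (a, b) = 0\<^sub>m n n $$ (a, b)"
        unfolding E_def using assms filtD[OF Z, of a 0]
        by (subst mult_munit_entry[OF UT_carrier[OF comp_UT[OF F]]]) auto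
    qed (use UT_mult[OF comp_UT[OF F] E] UT_carrier in auto)
    moreover have h: "h \<in> carrier G" using h supp_carrier[OF F] by blast
    ultimately have "comp F h * comp E g = comp (0\<^sub>m n n) (h \<otimes> g)"
      using comp_mult_left[OF h comp_in[OF F h] True E] by simp
    then show ?thesis
      by (simp add: UT_linear_zero[OF comp_linear] comp_UT image_subset_iff)
  qed
  have X: "comp E g \<in> carrier_mat n n" using comp_UT[OF E] UT_carrier by blast
  have "F * comp E g = msum n (supp F) (\<lambda>h. comp F h * comp E g)"
    using msum_comp_mult(1)[OF F comp_UT[OF E]] by simp
  then have "(F * comp E g) $$ (0, j) = 0"
    using zero assms by (simp add: msum_entry)
  then show ?thesis
    unfolding F_def using assms munit_mult_entry[OF X, of i 0 j 0] by (simp add: E_def)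
next
  case False
  then have "comp (munit n 0 0) g = 0\<^sub>m n n"
    using supp_carrier[OF munit_UT[of 0 0 n]] by (intro comp_zero) auto
  then show ?thesis using assms by simp
qed

text \<open>Passing from \<open>j\<close> to \<open>Suc j\<close> multiplies by
  \<open>munit n j (Suc j)\<close> on the right. Its components lie in \<open>filt n 1\<close>, so
  the first possibly non-zero position in row 0 moves one step to the right.\<close>

lemma comp_first_row:
  assumes "j < n" "a < n" "b < n" "a \<noteq> 0 \<or> b < j"
  shows "comp (munit n 0 j) g $$ (a, b) = 0"
  using assms
proof (induction j arbitrary: g a b)
  case 0
  then show ?case using comp_first_idempotent by simp
next
  case (Suc j)
  define X :: "'k mat" where "X = munit n 0 j"
  define Y :: "'k mat" where "Y = munit n j (Suc j)"
  have X: "X \<in> UT n" and Y: "Y \<in> UT n" unfolding X_def Y_def by (auto intro: munit_UT)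
  have XY: "X * Y = munit n 0 (Suc j)" unfolding X_def Y_def using Suc.prems by (simp add: munit_mult_munit)
  show ?case
  proof (cases "g \<in> carrier G")
    case True
    have "(comp X h * comp Y k) $$ (a, b) = 0" for h k
    proof -
      have "comp X h $$ (a, l) * comp Y k $$ (l, b) = 0" if l: "l < n" for l
      proof (cases "a \<noteq> 0 \<or> l < j")
        case True
        then show ?thesis using Suc.IH[of a l h] Suc.prems l by (simp add: X_def)
      next
        case False
        have "comp Y k \<in> filt n 1" unfolding Y_def using Suc.prems by (intro comp_munit_filt) auto
        \<comment> \<open>Here \<open>a = 0\<close> and \<open>j \<le> l\<close>, so
          \<open>b < Suc j\<close> gives \<open>b \<le> l\<close>, which is where a radical element
          vanishes.\<close>
        then show ?thesis using filtD[of "comp Y k" n 1 l b] False Suc.prems l by simp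
      qed
      then show ?thesis
        unfolding mult_entry[OF UT_carrier[OF comp_UT[OF X]] UT_carrier[OF comp_UT[OF Y]] Suc.prems(2,3)]
        by (intro sum.neutral) blast
    qed
    then show ?thesis
      using comp_mult[OF X Y True] Suc.prems by (simp add: XY msum_entry)
  next
    case False
    then have "comp (munit n 0 (Suc j)) g = 0\<^sub>m n n"
      using supp_carrier[OF munit_UT[of 0 "Suc j" n]] by (intro comp_zero) auto
    then show ?thesis using Suc.prems by simp
  qed
qed

text \<open>The components of \<open>munit n 0 i\<close> add up to entry 1 at \<open>(0, i)\<close>,
  so one of them is non-zero there; it becomes \<open>v i\<close> and its degree
  \<open>\<gamma> i\<close>. The zeros before position \<open>i\<close> make the family triangular,
  hence a basis of row 0.\<close>

lemma homogeneous_first_row_basis: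
  obtains \<gamma> v where "\<And>i. i < n \<Longrightarrow> \<gamma> i \<in> carrier G" "\<And>i. i < n \<Longrightarrow> v i \<in> \<Gamma> (\<gamma> i)"
    "\<And>i a b. i < n \<Longrightarrow> a < n \<Longrightarrow> b < n \<Longrightarrow> a \<noteq> 0 \<or> b < i \<Longrightarrow> v i $$ (a, b) = 0"
    "\<And>i. i < n \<Longrightarrow> v i $$ (0, i) \<noteq> 0"
proof -
  have "\<exists>g\<in>carrier G. comp (munit n 0 i) g $$ (0, i) \<noteq> 0" if i: "i < n" for i
  proof -
    have UT: "(munit n 0 i :: 'k mat) \<in> UT n" by (rule munit_UT) simp
    have "(\<Sum>g\<in>supp (munit n 0 i). comp (munit n 0 i) g $$ (0, i)) = 1"
      using i by (simp add: supp_entry_sum[OF UT] munit_entry)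
    then obtain g where "g \<in> supp (munit n 0 i)" "comp (munit n 0 i) g $$ (0, i) \<noteq> 0"
      by (metis sum.neutral zero_neq_one)
    then show ?thesis using supp_carrier[OF UT] by blast
  qed
  then obtain \<gamma> where \<gamma>: "\<And>i. i < n \<Longrightarrow> \<gamma> i \<in> carrier G"
    "\<And>i. i < n \<Longrightarrow> comp (munit n 0 i) (\<gamma> i) $$ (0, i) \<noteq> 0"
    by metis
  show thesis
    using \<gamma> comp_in[OF munit_UT] comp_first_row
    by (intro that[of \<gamma> "\<lambda>i. comp (munit n 0 i) (\<gamma> i)"]) auto
qed

text \<open>The conjugating matrix has as rows the first rows of a homogeneous basis of the right ideal
  of matrices concentrated in row \<open>0\<close>, chosen compatibly with the flag of subideals.\<close>

lemma elementary_support: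
  obtains \<alpha> \<gamma> where "automorphism n \<alpha>" "\<And>i. i < n \<Longrightarrow> \<gamma> i \<in> carrier G"
    "\<And>g x i j. g \<in> carrier G \<Longrightarrow> x \<in> \<Gamma> g \<Longrightarrow> i < n \<Longrightarrow> j < n \<Longrightarrow> \<alpha> x $$ (i, j) \<noteq> 0
      \<Longrightarrow> inv (\<gamma> i) \<otimes> \<gamma> j = g"
proof -
  obtain \<gamma> v where \<gamma>: "\<And>i. i < n \<Longrightarrow> \<gamma> i \<in> carrier G" and v: "\<And>i. i < n \<Longrightarrow> v i \<in> \<Gamma> (\<gamma> i)"
    and v0: "\<And>i a b. i < n \<Longrightarrow> a < n \<Longrightarrow> b < n \<Longrightarrow> a \<noteq> 0 \<or> b < i \<Longrightarrow> v i $$ (a, b) = 0"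
    and vdiag: "\<And>i. i < n \<Longrightarrow> v i $$ (0, i) \<noteq> 0"
    by (rule homogeneous_first_row_basis) blast
  define P where "P = mat n n (\<lambda>(i, j). v i $$ (0, j))"
  have P: "P \<in> UT n"
    using v0 by (auto simp: P_def UT_def intro!: upper_triangularI)
  obtain Q where Q: "Q \<in> UT n" "P * Q = 1\<^sub>m n" "Q * P = 1\<^sub>m n"
    using UT_inverse[OF P] vdiag by (auto simp: P_def)
  have Pc: "P \<in> carrier_mat n n" and Qc: "Q \<in> carrier_mat n n" using P Q UT_carrier by blast+
  have vUT: "v i \<in> UT n" if "i < n" for i using that v \<gamma> \<Gamma>_UT by blast
  have "inv (\<gamma> i) \<otimes> \<gamma> j = g"
    if g: "g \<in> carrier G" and x: "x \<in> \<Gamma> g" and i: "i < n" and j: "j < n"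
      and nz: "(P * x * Q) $$ (i, j) \<noteq> 0" for g x i j
  proof (rule ccontr)
    \<comment> \<open>\<open>v i * x\<close> is homogeneous of degree
      \<open>\<gamma> i \<otimes> g\<close>; if this is not \<open>\<gamma> j\<close>, no basis
      vector of degree \<open>\<gamma> j\<close> can occur in its expansion.\<close>
    assume "inv (\<gamma> i) \<otimes> \<gamma> j \<noteq> g"
    then have neq: "\<gamma> j \<noteq> \<gamma> i \<otimes> g"
      using \<gamma>[OF i] \<gamma>[OF j] g by (auto simp: m_assoc[symmetric])
    define C where "C = P * x * Q"
    have xUT: "x \<in> UT n" using g x \<Gamma>_UT by blast
    then have xc: "x \<in> carrier_mat n n" by (rule UT_carrier)
    have Cc: "C \<in> carrier_mat n n" using Pc Qc xc by (simp add: C_def)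
    \<comment> \<open>Read row by row, this says that row \<open>i\<close> of \<open>C\<close> holds
      the coordinates of \<open>v i * x\<close> in the basis \<open>v\<close>.\<close>
    have CP: "C * P = P * x"
      unfolding C_def using Pc Qc xc Q by (simp add: assoc_mult_mat[of _ n n _ n _ n])
    have UT: "C $$ (i, l) \<cdot>\<^sub>m v l \<in> UT n" if "l \<in> {..<n}" for l
      using that vUT by (intro UT_smult) simp
    have "v i * x = msum n {..<n} (\<lambda>l. C $$ (i, l) \<cdot>\<^sub>m v l)"
    proof (rule mat_eqI[of _ n])
      show "v i * x \<in> carrier_mat n n" using UT_mult[OF vUT[OF i] xUT] by (rule UT_carrier)
      fix a b assume ab: "a < n" "b < n"
      have "(v i * x) $$ (a, b) = (\<Sum>l<n. v i $$ (a, l) * x $$ (l, b))"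
        by (rule mult_entry[OF UT_carrier[OF vUT[OF i]] xc ab])
      also have "\<dots> = (\<Sum>l<n. C $$ (i, l) * v l $$ (a, b))"
      proof (cases "a = 0")
        case True
        have "(\<Sum>l<n. v i $$ (a, l) * x $$ (l, b)) = (P * x) $$ (i, b)"
          unfolding mult_entry[OF Pc xc i ab(2)] using i True by (simp add: P_def)
        also have "\<dots> = (\<Sum>l<n. C $$ (i, l) * v l $$ (a, b))"
          unfolding CP[symmetric] mult_entry[OF Cc Pc i ab(2)] using ab True by (simp add: P_def)
        finally show ?thesis .
      next
        case False
        then show ?thesis using v0 i ab by simp
      qed
      also have "\<dots> = msum n {..<n} (\<lambda>l. C $$ (i, l) \<cdot>\<^sub>m v l) $$ (a, b)"
        unfolding msum_entry[OF ab]
        using ab carrier_matD[OF UT_carrier[OF vUT]] by (intro sum.cong) auto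
      finally show "(v i * x) $$ (a, b) = msum n {..<n} (\<lambda>l. C $$ (i, l) \<cdot>\<^sub>m v l) $$ (a, b)" .
    qed (rule msum_carrier)
    then have "comp (v i * x) (\<gamma> j) = msum n {..<n} (\<lambda>l. comp (C $$ (i, l) \<cdot>\<^sub>m v l) (\<gamma> j))"
      using comp_msum[OF finite_lessThan UT, where g = "\<gamma> j"] by simp
    moreover have "comp (v i * x) (\<gamma> j) = 0\<^sub>m n n"
      using comp_homogeneous[OF _ \<Gamma>_mult[OF \<gamma>[OF i] g v[OF i] x], of "\<gamma> j"] \<gamma>[OF i] g neq by simp
    ultimately have zero: "msum n {..<n} (\<lambda>l. comp (C $$ (i, l) \<cdot>\<^sub>m v l) (\<gamma> j)) = 0\<^sub>m n n"
      by simp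
    \<comment> \<open>Every row of \<open>D\<close> repeats the coordinates whose basis vectors have
      degree \<open>\<gamma> j\<close>. The square shape lets linear independence of the basis be
      used as cancellation of \<open>P\<close>.\<close>
    define D where "D = mat n n (\<lambda>(_, l). if \<gamma> l = \<gamma> j then C $$ (i, l) else 0)"
    have D: "D \<in> carrier_mat n n" by (simp add: D_def)
    have DP: "D * P = 0\<^sub>m n n"
    proof (rule mat_eqI[of _ n])
      fix a b assume ab: "a < n" "b < n"
      have "(D * P) $$ (a, b) = (\<Sum>l<n. comp (C $$ (i, l) \<cdot>\<^sub>m v l) (\<gamma> j) $$ (0, b))"
        unfolding mult_entry[OF D Pc ab]
      proof (rule sum.cong[OF refl])
        fix l assume "l \<in> {..<n}"
        then have l: "l < n" by simp
        show "D $$ (a, l) * P $$ (l, b) = comp (C $$ (i, l) \<cdot>\<^sub>m v l) (\<gamma> j) $$ (0, b)"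
          using comp_homogeneous[OF \<gamma>[OF l] \<Gamma>_smult[OF \<gamma>[OF l] v[OF l]], of "C $$ (i, l)" "\<gamma> j"]
            l ab carrier_matD[OF UT_carrier[OF vUT[OF l]]]
          by (auto simp: D_def P_def)
      qed
      also have "\<dots> = 0"
        using arg_cong[OF zero, of "\<lambda>z. z $$ (0, b)"] ab by (simp add: msum_entry)
      finally show "(D * P) $$ (a, b) = 0\<^sub>m n n $$ (a, b)" using ab by simp
    qed (use D Pc in auto)
    have "D = D * P * Q"
      using D Pc Qc Q by (simp add: assoc_mult_mat[of _ n n _ n _ n])
    then have "D = 0\<^sub>m n n" using DP Qc by simp
    then have "D $$ (i, j) = 0"
      using i j by simp
    then have "C $$ (i, j) = 0"
      using i j by (simp add: D_def)
    then show False using nz by (simp add: C_def)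
  qed
  then show thesis
    using conjugation_automorphism[OF P Q] \<gamma> by (intro that[of "\<lambda>x. P * x * Q" \<gamma>]) auto
qed

end

subsection \<open>Automorphisms and antiautomorphisms\<close>

lemma automorphism_UT: "automorphism n f \<Longrightarrow> x \<in> UT n \<Longrightarrow> f x \<in> UT n"
  by (auto simp: automorphism_def bij_betw_def)

lemma antiautomorphism_UT: "antiautomorphism n f \<Longrightarrow> x \<in> UT n \<Longrightarrow> f x \<in> UT n"
  by (auto simp: antiautomorphism_def bij_betw_def)

lemma automorphism_inverse:
  assumes "automorphism n f"
  shows "automorphism n (inv_into (UT n) f)"
    and "\<And>x. x \<in> UT n \<Longrightarrow> f (inv_into (UT n) f x) = x"
    and "\<And>x. x \<in> UT n \<Longrightarrow> inv_into (UT n) f (f x) = x"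
proof -
  let ?g = "inv_into (UT n) f"
  have bij: "bij_betw f (UT n) (UT n)" and lin: "UT_linear n f"
    and mult: "\<And>x y. x \<in> UT n \<Longrightarrow> y \<in> UT n \<Longrightarrow> f (x * y) = f x * f y"
    using assms by (auto simp: automorphism_def)
  show fg: "f (?g x) = x" if "x \<in> UT n" for x
    using bij that by (rule bij_betw_inv_into_right)
  show gf: "?g (f x) = x" if "x \<in> UT n" for x
    using bij that by (rule bij_betw_inv_into_left)
  have bij': "bij_betw ?g (UT n) (UT n)" using bij by (rule bij_betw_inv_into)
  have g: "?g x \<in> UT n" if "x \<in> UT n" for x
    using bij' that by (auto simp: bij_betw_def)
  have "?g (x + y) = ?g x + ?g y" if "x \<in> UT n" "y \<in> UT n" for x y
    using gf[OF UT_add[OF g g], OF that] lin g that fg by (simp add: UT_linear_def)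
  moreover have "?g (c \<cdot>\<^sub>m x) = c \<cdot>\<^sub>m ?g x" if "x \<in> UT n" for c x
    using gf[OF UT_smult[OF g], OF that, of c] lin g that fg by (simp add: UT_linear_def)
  moreover have "?g (x * y) = ?g x * ?g y" if "x \<in> UT n" "y \<in> UT n" for x y
    using gf[OF UT_mult[OF g g], OF that] mult g that fg by simp
  ultimately show "automorphism n ?g"
    using bij' by (simp add: automorphism_def UT_linear_def)
qed

lemma antiautomorphism_conj:
  assumes "automorphism n f" "antiautomorphism n \<phi>" "automorphism n g"
  shows "antiautomorphism n (f \<circ> \<phi> \<circ> g)"
proof -
  have "bij_betw (f \<circ> \<phi> \<circ> g) (UT n) (UT n)"
    using assms by (auto simp: automorphism_def antiautomorphism_def intro: bij_betw_trans)
  then show ?thesis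
    using assms automorphism_UT[OF assms(3)] antiautomorphism_UT[OF assms(2)]
    by (simp add: automorphism_def antiautomorphism_def UT_linear_def)
qed

lemma antiautomorphism_comp:
  assumes "antiautomorphism n \<phi>" "antiautomorphism n \<psi>"
  shows "automorphism n (\<phi> \<circ> \<psi>)"
proof -
  have "bij_betw (\<phi> \<circ> \<psi>) (UT n) (UT n)"
    using assms by (auto simp: antiautomorphism_def intro: bij_betw_trans)
  then show ?thesis
    using assms antiautomorphism_UT[OF assms(2)]
    by (simp add: automorphism_def antiautomorphism_def UT_linear_def)
qed

section \<open>The canonical involution is an antiautomorphism\<close>

lemma canon_entry: "i < n \<Longrightarrow> j < n \<Longrightarrow> canon n x $$ (i, j) = x $$ (n - 1 - j, n - 1 - i)"
  by (simp add: canon_def)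

lemma canon_carrier: "canon n x \<in> carrier_mat n n"
  by (simp add: canon_def)

lemma canon_UT: "x \<in> UT n \<Longrightarrow> canon n x \<in> UT n"
  unfolding UT_eq_filt by (rule filtI[OF canon_carrier]) (auto simp: canon_entry intro!: filtD)

lemma canon_canon: "x \<in> UT n \<Longrightarrow> canon n (canon n x) = x"
  by (intro mat_eqI[of _ n] canon_carrier UT_carrier) (auto simp: canon_entry)

lemma canon_mult:
  assumes "x \<in> UT n" "y \<in> UT n"
  shows "canon n (x * y) = canon n y * canon n x"
proof (rule mat_eqI[of _ n])
  fix i j assume ij: "i < n" "j < n"
  have "canon n (x * y) $$ (i, j) = (\<Sum>k<n. x $$ (n - 1 - j, k) * y $$ (k, n - 1 - i))"
    using ij mult_entry[OF UT_carrier UT_carrier, OF assms] by (simp add: canon_entry del: index_mult_mat)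
  also have "\<dots> = (\<Sum>k<n. x $$ (n - 1 - j, n - 1 - k) * y $$ (n - 1 - k, n - 1 - i))"
    by (rule sum.reindex_bij_witness[where i = "\<lambda>k. n - 1 - k" and j = "\<lambda>k. n - 1 - k"]) auto
  also have "\<dots> = (canon n y * canon n x) $$ (i, j)"
    unfolding mult_entry[OF canon_carrier canon_carrier ij]
    using ij by (intro sum.cong) (auto simp: canon_entry mult.commute)
  finally show "canon n (x * y) $$ (i, j) = (canon n y * canon n x) $$ (i, j)" .
qed (auto intro!: mult_carrier_mat canon_carrier)

lemma canon_antiautomorphism: "antiautomorphism n (canon n)"
proof -
  have "bij_betw (canon n) (UT n) (UT n)"
    using canon_UT canon_canon by (intro bij_betw_byWitness[where f' = "canon n"]) auto
  then show ?thesis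
    by (simp add: antiautomorphism_def canon_linear canon_mult)
qed

section \<open>Images of matrix units under antiautomorphisms\<close>

lemma munit_mult_munit_neq:
  assumes "j < n" "j \<noteq> k"
  shows "munit n i j * munit n k l = 0\<^sub>m n n"
proof (rule mat_eqI[of _ n])
  fix a b assume ab: "a < n" "b < n"
  then show "(munit n i j * munit n k l) $$ (a, b) = 0\<^sub>m n n $$ (a, b)"
    unfolding munit_mult_entry[OF munit_carrier assms(1) ab] using assms by (simp add: munit_entry)
qed (auto intro!: mult_carrier_mat munit_carrier)

lemma antiautomorphism_zero: "antiautomorphism n \<phi> \<Longrightarrow> \<phi> (0\<^sub>m n n) = 0\<^sub>m n n"
  using antiautomorphism_UT by (intro UT_linear_zero) (auto simp: antiautomorphism_def)

text \<open>The image of \<open>munit n j (Suc j)\<close> squares to zero, so its diagonal vanishes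
  and it lies in \<open>filt n 1\<close>. Since \<open>munit n i j\<close> is a product of
  \<open>j - i\<close> such units, its image has that filtration degree.\<close>

lemma antiautomorphism_munit_filt:
  assumes \<phi>: "antiautomorphism n \<phi>" and "i \<le> j" "j < n"
  shows "\<phi> (munit n i j) \<in> filt n (j - i)"
  using assms(2,3)
proof (induction j rule: dec_induct)
  case base
  then show ?case using antiautomorphism_UT[OF \<phi> munit_UT[of i i]] by (simp add: UT_eq_filt)
next
  case (step j)
  define y where "y = \<phi> (munit n j (Suc j))"
  have mu: "munit n j (Suc j) \<in> UT n" "munit n i j \<in> UT n" using step by (auto intro: munit_UT)
  have mult: "\<phi> (a * b) = \<phi> b * \<phi> a" if "a \<in> UT n" "b \<in> UT n" for a b
    using \<phi> that by (simp add: antiautomorphism_def)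
  have y: "y \<in> UT n" unfolding y_def using \<phi> mu(1) by (rule antiautomorphism_UT)
  have "y * y = \<phi> (munit n j (Suc j) * munit n j (Suc j))"
    using mult[OF mu(1) mu(1)] by (simp add: y_def)
  also have "\<dots> = 0\<^sub>m n n"
    using step by (simp add: munit_mult_munit_neq antiautomorphism_zero[OF \<phi>])
  finally have "y $$ (a, a) = 0" if "a < n" for a
    using UT_mult_diag[OF y y that] that by simp
  then have "y \<in> filt n 1"
    using UT_entry[OF y] UT_carrier[OF y] by (intro filtI) (auto simp: less_Suc_eq)
  moreover have "munit n i (Suc j) = munit n i j * (munit n j (Suc j) :: 'a mat)"
    using step by (simp add: munit_mult_munit)
  then have "\<phi> (munit n i (Suc j)) = y * \<phi> (munit n i j)"
    using mult[OF mu(2,1)] by (simp add: y_def)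
  ultimately show ?case
    using filt_mult[of y n 1 "\<phi> (munit n i j)" "j - i"] step by (simp add: Suc_diff_le)
qed

text \<open>Factor \<open>munit n 0 (n - 1)\<close> through \<open>munit n i j\<close>: in the corner entry of the image, the
  filtration degrees leave a single product, which contains the entry in question.\<close>

lemma antiautomorphism_munit_entry:
  assumes \<phi>: "antiautomorphism n \<phi>" and ij: "i \<le> j" "j < n"
  shows "\<phi> (munit n i j) $$ (n - 1 - j, n - 1 - i) \<noteq> 0"
proof
  let ?x = "\<phi> (munit n 0 i)" and ?y = "\<phi> (munit n i j)" and ?z = "\<phi> (munit n j (n - 1))"
    and ?t = "\<phi> (munit n 0 (n - 1))"
  assume y0: "?y $$ (n - 1 - j, n - 1 - i) = 0"
  have mu: "munit n 0 i \<in> UT n" "munit n i j \<in> UT n" "munit n j (n - 1) \<in> UT n"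
    using ij by (auto intro: munit_UT)
  have mult: "\<phi> (a * b) = \<phi> b * \<phi> a" if "a \<in> UT n" "b \<in> UT n" for a b
    using \<phi> that by (simp add: antiautomorphism_def)
  have "munit n 0 (n - 1) = munit n 0 i * munit n i j * (munit n j (n - 1) :: 'a mat)"
    using ij by (simp add: munit_mult_munit)
  then have t: "?t = ?z * (?y * ?x)"
    using mult[OF UT_mult[OF mu(1,2)] mu(3)] mult[OF mu(1,2)] by simp
  have x: "?x \<in> filt n i" and y: "?y \<in> filt n (j - i)" and z: "?z \<in> filt n (n - 1 - j)"
    and tf: "?t \<in> filt n (n - 1)"
    using antiautomorphism_munit_filt[OF \<phi>, of 0 i] antiautomorphism_munit_filt[OF \<phi>, of i j]
      antiautomorphism_munit_filt[OF \<phi>, of j "n - 1"] antiautomorphism_munit_filt[OF \<phi>, of 0 "n - 1"] ij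
    by auto
  have idx: "n - 1 - j + (j - i) = n - 1 - i" "n - 1 - i + i = n - 1" "n - 1 - j + j = n - 1"
    "j - i + i = j" using ij by auto
  have "?t $$ (0, n - 1) = 0"
    unfolding t using filt_mult_entry[OF z filt_mult[OF y x], of 0]
      filt_mult_entry[OF y x, of "n - 1 - j"] y0 ij by (simp add: idx)
  \<comment> \<open>The filtration leaves only the corner entry, which was just shown to vanish;
    injectivity is then violated at \<open>munit n 0 (n - 1)\<close>.\<close>
  have "?t = 0\<^sub>m n n"
  proof (rule mat_eqI[of _ n])
    fix a b assume ab: "a < n" "b < n"
    show "?t $$ (a, b) = 0\<^sub>m n n $$ (a, b)"
    proof (cases "a = 0 \<and> b = n - 1")
      case True
      then show ?thesis using \<open>?t $$ (0, n - 1) = 0\<close> ab by simp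
    next
      case False
      then show ?thesis using filtD[OF tf ab] ab by force
    qed
  qed (use filt_carrier[OF tf] in auto)
  then have "\<phi> (munit n 0 (n - 1)) = \<phi> (0\<^sub>m n n)"
    using antiautomorphism_zero[OF \<phi>] by simp
  then have "munit n 0 (n - 1) = (0\<^sub>m n n :: 'a mat)"
    using \<phi> munit_UT[of 0 "n - 1" n] UT_zero[of n]
    unfolding antiautomorphism_def bij_betw_def inj_on_def by blast
  then show False using munit_neq_zero[of 0 n "n - 1", where ?'k = 'a] ij by simp
qed

subsection \<open>Transport of gradings\<close>

lemma decomp_image:
  assumes \<alpha>: "automorphism n \<alpha>" and \<Gamma>: "\<And>g. g \<in> carrier G \<Longrightarrow> \<Gamma> g \<subseteq> UT n"
    and c: "decomp n G \<Gamma> x c"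
  shows "decomp n G (\<lambda>g. \<alpha> ` \<Gamma> g) (\<alpha> x) (\<lambda>g. \<alpha> (c g))"
proof -
  have lin: "UT_linear n \<alpha>" "\<alpha> ` UT n \<subseteq> UT n" and inj: "inj_on \<alpha> (UT n)"
    using \<alpha> by (auto simp: automorphism_def bij_betw_def)
  have cUT: "c g \<in> UT n" for g
    using c \<Gamma>[of g] UT_zero[of n] by (cases "g \<in> carrier G") (auto simp: decomp_def)
  have "\<alpha> (c g) = 0\<^sub>m n n \<longleftrightarrow> c g = 0\<^sub>m n n" for g
    using inj_onD[OF inj _ cUT UT_zero, of g] UT_linear_zero[OF lin] by auto
  then show ?thesis
    using c UT_linear_msum[OF lin _ cUT, of "{g. c g \<noteq> 0\<^sub>m n n}" "\<lambda>g. g"]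
    by (auto simp: decomp_def UT_linear_zero[OF lin])
qed

lemma is_grading_image:
  assumes \<alpha>: "automorphism n \<alpha>" and \<Gamma>: "is_grading n G \<Gamma>"
  shows "is_grading n G (\<lambda>g. \<alpha> ` \<Gamma> g)"
proof -
  let ?\<beta> = "inv_into (UT n) \<alpha>"
  note \<beta> = automorphism_inverse[OF \<alpha>]
  have sub: "UT_subspace n (\<Gamma> g)" if "g \<in> carrier G" for g
    using \<Gamma> that by (simp add: is_grading_iff)
  then have UT: "\<Gamma> g \<subseteq> UT n" if "g \<in> carrier G" for g
    using that by (auto simp: UT_subspace_def)
  have lin: "UT_linear n \<alpha>" "\<alpha> ` UT n \<subseteq> UT n"
    using \<alpha> by (auto simp: automorphism_def bij_betw_def)
  have "UT_subspace n (\<alpha> ` \<Gamma> g)" if g: "g \<in> carrier G" for g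
    unfolding UT_subspace_def
  proof (intro conjI ballI allI)
    show "\<alpha> ` \<Gamma> g \<subseteq> UT n" using UT[OF g] lin(2) by blast
    show "0\<^sub>m n n \<in> \<alpha> ` \<Gamma> g"
      using UT_linear_zero[OF lin] sub[OF g] by (metis UT_subspace_def image_eqI)
    fix x assume "x \<in> \<alpha> ` \<Gamma> g"
    then obtain x' where x: "x' \<in> \<Gamma> g" "x = \<alpha> x'" by blast
    show "c \<cdot>\<^sub>m x \<in> \<alpha> ` \<Gamma> g" for c
    proof (rule image_eqI)
      show "c \<cdot>\<^sub>m x = \<alpha> (c \<cdot>\<^sub>m x')" using x UT[OF g] lin by (auto simp: UT_linear_def)
      show "c \<cdot>\<^sub>m x' \<in> \<Gamma> g" using x sub[OF g] by (simp add: UT_subspace_def)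
    qed
    fix y assume "y \<in> \<alpha> ` \<Gamma> g"
    then obtain y' where y: "y' \<in> \<Gamma> g" "y = \<alpha> y'" by blast
    show "x + y \<in> \<alpha> ` \<Gamma> g"
    proof (rule image_eqI)
      show "x + y = \<alpha> (x' + y')" using x y UT[OF g] lin(1) by (simp add: UT_linear_def subset_iff)
      show "x' + y' \<in> \<Gamma> g" using x y sub[OF g] by (simp add: UT_subspace_def)
    qed
  qed
  moreover have "x * y \<in> \<alpha> ` \<Gamma> (g \<otimes>\<^bsub>G\<^esub> h)"
    if gh: "g \<in> carrier G" "h \<in> carrier G" and im: "x \<in> \<alpha> ` \<Gamma> g" "y \<in> \<alpha> ` \<Gamma> h" for g h x y
  proof -
    obtain x' y' where xy: "x' \<in> \<Gamma> g" "x = \<alpha> x'" "y' \<in> \<Gamma> h" "y = \<alpha> y'" using im by blast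
    show ?thesis
    proof (rule image_eqI)
      show "x * y = \<alpha> (x' * y')"
        using xy UT[OF gh(1)] UT[OF gh(2)] \<alpha> by (simp add: automorphism_def subset_iff)
      show "x' * y' \<in> \<Gamma> (g \<otimes>\<^bsub>G\<^esub> h)" using \<Gamma> gh xy by (simp add: is_grading_iff)
    qed
  qed
  moreover have "\<exists>!c. decomp n G (\<lambda>g. \<alpha> ` \<Gamma> g) x c" if x: "x \<in> UT n" for x
  proof -
    have "?\<beta> x \<in> UT n" using automorphism_UT[OF \<beta>(1) x] .
    then have ex1: "\<exists>!c. decomp n G \<Gamma> (?\<beta> x) c" using \<Gamma> by (simp add: is_grading_iff)
    then obtain c where c: "decomp n G \<Gamma> (?\<beta> x) c" by blast
    have "decomp n G (\<lambda>g. \<alpha> ` \<Gamma> g) x (\<lambda>g. \<alpha> (c g))"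
      using decomp_image[OF \<alpha> UT c] \<beta>(2)[OF x] by simp
    moreover have "d = (\<lambda>g. \<alpha> (c g))" if d: "decomp n G (\<lambda>g. \<alpha> ` \<Gamma> g) x d" for d
    \<comment> \<open>Uniqueness is pulled back: the inverse of \<open>\<alpha>\<close> carries any
      decomposition \<open>d\<close> to one for the original grading.\<close>
    proof -
      have im: "?\<beta> ` \<alpha> ` \<Gamma> g = \<Gamma> g" if "g \<in> carrier G" for g
        using UT[OF that] \<beta>(3) by (force simp: image_image)
      have UT': "\<alpha> ` \<Gamma> g \<subseteq> UT n" if "g \<in> carrier G" for g
        using UT[OF that] lin(2) by blast
      have "decomp n G \<Gamma> (?\<beta> x) (\<lambda>g. ?\<beta> (d g))"
        using decomp_image[OF \<beta>(1) UT' d] im unfolding decomp_def by simp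
      then have "c = (\<lambda>g. ?\<beta> (d g))" using c ex1 by blast
      moreover have "d g \<in> UT n" for g
        using d UT'[of g] UT_zero[of n] by (cases "g \<in> carrier G") (auto simp: decomp_def)
      ultimately show ?thesis using \<beta>(2) by auto
    qed
    ultimately show ?thesis by blast
  qed
  ultimately show ?thesis unfolding is_grading_iff by blast
qed

text \<open>The permutation of degrees is exposed because two maps inducing the same
  \<open>\<theta>\<close> have to be compared; \<open>homogeneous\<close> hides it behind a
  quantifier.\<close>

definition homogeneous_via ::
  "nat \<Rightarrow> ('g, 'b) monoid_scheme \<Rightarrow> ('g \<Rightarrow> 'k::field mat set) \<Rightarrow> ('g \<Rightarrow> 'g) \<Rightarrow> ('k mat \<Rightarrow> 'k mat) \<Rightarrow> bool" where
  "homogeneous_via n G \<Gamma> \<theta> f \<longleftrightarrow>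
     bij_betw \<theta> (Supp n G \<Gamma>) (Supp n G \<Gamma>) \<and> (\<forall>g\<in>Supp n G \<Gamma>. f ` \<Gamma> g = \<Gamma> (\<theta> g))"

lemma homogeneous_iff: "homogeneous n G \<Gamma> f \<longleftrightarrow> (\<exists>\<theta>. homogeneous_via n G \<Gamma> \<theta> f)"
  by (simp add: homogeneous_def homogeneous_via_def)

lemma homogeneous_via_Supp:
  "homogeneous_via n G \<Gamma> \<theta> f \<Longrightarrow> g \<in> Supp n G \<Gamma> \<Longrightarrow> \<theta> g \<in> Supp n G \<Gamma>"
  unfolding homogeneous_via_def by (blast intro: bij_betw_apply)

lemma inv_into_image:
  assumes \<alpha>: "automorphism n \<alpha>" and "W \<subseteq> UT n"
  shows "inv_into (UT n) \<alpha> ` \<alpha> ` W = W"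
  using assms(2) automorphism_inverse(3)[OF \<alpha>] by (force simp: image_image)

lemma Supp_image:
  assumes \<alpha>: "automorphism n \<alpha>" and \<Gamma>: "\<And>g. g \<in> carrier G \<Longrightarrow> \<Gamma> g \<subseteq> UT n"
    and "\<And>g. g \<in> carrier G \<Longrightarrow> \<alpha> ` \<Gamma> g = \<Gamma>' g"
  shows "Supp n G \<Gamma>' = Supp n G \<Gamma>"
proof -
  have zero: "\<alpha> (0\<^sub>m n n) = 0\<^sub>m n n"
    using \<alpha> by (intro UT_linear_zero) (auto simp: automorphism_def bij_betw_def)
  have "\<Gamma>' g = {0\<^sub>m n n} \<longleftrightarrow> \<Gamma> g = {0\<^sub>m n n}" if g: "g \<in> carrier G" for g
  proof
    assume "\<Gamma>' g = {0\<^sub>m n n}"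
    then have "\<Gamma> g = inv_into (UT n) \<alpha> ` {0\<^sub>m n n}"
      using inv_into_image[OF \<alpha> \<Gamma>[OF g]] assms(3)[OF g] by simp
    then show "\<Gamma> g = {0\<^sub>m n n}"
      using automorphism_inverse(3)[OF \<alpha> UT_zero] zero by simp
  next
    assume "\<Gamma> g = {0\<^sub>m n n}"
    then show "\<Gamma>' g = {0\<^sub>m n n}" using assms(3)[OF g] zero by auto
  qed
  then show ?thesis by (auto simp: Supp_def)
qed

text \<open>A graded isomorphism preserves degrees, so the conjugated map induces the very same
  \<open>\<theta>\<close>.\<close>

lemma homogeneous_via_conj:
  assumes \<alpha>: "automorphism n \<alpha>" and \<Gamma>: "\<And>g. g \<in> carrier G \<Longrightarrow> \<Gamma> g \<subseteq> UT n"
    and \<Gamma>': "\<And>g. g \<in> carrier G \<Longrightarrow> \<alpha> ` \<Gamma> g = \<Gamma>' g"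
    and f: "homogeneous_via n G \<Gamma> \<theta> f"
  shows "homogeneous_via n G \<Gamma>' \<theta> (\<alpha> \<circ> f \<circ> inv_into (UT n) \<alpha>)"
proof -
  have "(\<alpha> \<circ> f \<circ> inv_into (UT n) \<alpha>) ` \<Gamma>' g = \<Gamma>' (\<theta> g)" if g: "g \<in> Supp n G \<Gamma>" for g
  proof -
    have "g \<in> carrier G" "\<theta> g \<in> carrier G"
      using f g by (auto simp: homogeneous_via_def Supp_def bij_betw_def)
    then have "\<alpha> ` f ` inv_into (UT n) \<alpha> ` \<Gamma>' g = \<Gamma>' (\<theta> g)"
      using inv_into_image[OF \<alpha> \<Gamma>, of g] \<Gamma>' f g unfolding homogeneous_via_def by metis
    then show ?thesis by (simp only: image_comp comp_assoc)
  qed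
  then show ?thesis
    using f Supp_image[where G = G and \<Gamma> = \<Gamma> and \<Gamma>' = \<Gamma>', OF \<alpha> \<Gamma> \<Gamma>'] by (simp add: homogeneous_via_def)
qed

text \<open>The witness is \<open>canon n \<circ> \<phi>\<close>. Since both maps send
  \<open>\<Gamma> g\<close> to the same component and \<open>canon n\<close> is its own inverse, the
  composite maps every component onto itself.\<close>

lemma canon_comp_graded_automorphism:
  assumes \<phi>: "antiautomorphism n \<phi>" "homogeneous_via n G \<Gamma> \<theta> \<phi>"
    and canon: "homogeneous_via n G \<Gamma> \<theta> (canon n)"
    and \<Gamma>: "\<And>g. g \<in> carrier G \<Longrightarrow> \<Gamma> g \<subseteq> UT n"
  shows "\<exists>\<psi>. graded_automorphism n G \<Gamma> \<psi> \<and> (\<forall>x\<in>UT n. \<phi> x = canon n (\<psi> x))"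
proof (intro exI conjI ballI)
  have "(canon n \<circ> \<phi>) ` \<Gamma> g = \<Gamma> g" if g: "g \<in> carrier G" for g
  proof (cases "g \<in> Supp n G \<Gamma>")
    case True
    then have "(canon n \<circ> \<phi>) ` \<Gamma> g = canon n ` canon n ` \<Gamma> g"
      using \<phi>(2) canon unfolding homogeneous_via_def image_comp[symmetric] by metis
    also have "\<dots> = \<Gamma> g"
      using canon_canon \<Gamma>[OF g] by (force simp: image_image)
    finally show ?thesis .
  next
    case False
    then have "\<Gamma> g = {0\<^sub>m n n}" using g by (simp add: Supp_def)
    then show ?thesis
      using antiautomorphism_zero[OF \<phi>(1)] antiautomorphism_zero[OF canon_antiautomorphism] by simp
  qed
  then show "graded_automorphism n G \<Gamma> (canon n \<circ> \<phi>)"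
    using antiautomorphism_comp[OF canon_antiautomorphism \<phi>(1)] by (simp add: graded_automorphism_def)
  show "\<phi> x = canon n ((canon n \<circ> \<phi>) x)" if "x \<in> UT n" for x
    using canon_canon[OF antiautomorphism_UT[OF \<phi>(1) that]] by simp
qed

subsection \<open>Homogeneous antiautomorphisms and the canonical involution\<close>

context UT_grading
begin

text \<open>If every matrix position belongs to a single degree, the components of \<open>x\<close>
  have disjoint supports and cannot cancel. A non-zero component of degree \<open>h\<close>
  therefore leaves a non-zero entry in \<open>x\<close>, which forces \<open>h = g\<close>.\<close>

lemma mem_of_support:
  assumes supp: "\<And>h y i j. h \<in> carrier G \<Longrightarrow> y \<in> \<Gamma> h \<Longrightarrow> i < n \<Longrightarrow> j < n \<Longrightarrow> y $$ (i, j) \<noteq> 0 \<Longrightarrow> d i j = h"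
    and x: "x \<in> UT n" and g: "g \<in> carrier G"
    and xg: "\<And>i j. i < n \<Longrightarrow> j < n \<Longrightarrow> x $$ (i, j) \<noteq> 0 \<Longrightarrow> d i j = g"
  shows "x \<in> \<Gamma> g"
proof -
  have "h = g" if h: "h \<in> supp x" for h
  proof -
    have hG: "k \<in> carrier G" if "k \<in> supp x" for k using that supp_carrier[OF x] by blast
    have "\<exists>i<n. \<exists>j<n. comp x h $$ (i, j) \<noteq> 0"
    proof (rule ccontr)
      assume "\<not> ?thesis"
      then have "comp x h = 0\<^sub>m n n"
        using UT_carrier[OF comp_UT[OF x]] by (intro mat_eqI[of _ n]) auto
      then show False using h by (simp add: supp_def)
    qed
    then obtain i j where ij: "i < n" "j < n" "comp x h $$ (i, j) \<noteq> 0" by blast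
    have d: "d i j = h" using supp[OF hG[OF h] comp_in[OF x hG[OF h]] ij] .
    have "comp x k $$ (i, j) = 0" if "k \<in> supp x" "k \<noteq> h" for k
      using supp[OF hG comp_in[OF x hG] ij(1,2), OF that(1) that(1)] d that(2) by blast
    then have "(\<Sum>k\<in>supp x. comp x k $$ (i, j)) = (\<Sum>k\<in>{h}. comp x k $$ (i, j))"
      using supp_finite[OF x] h by (intro sum.mono_neutral_right) auto
    then have "x $$ (i, j) \<noteq> 0"
      using ij by (simp add: supp_entry_sum[OF x])
    then show "h = g" using xg ij d by blast
  qed
  then have "comp x h \<in> \<Gamma> g" if "h \<in> supp x" for h
    using that comp_in[OF x] g by blast
  then show ?thesis
    using msum_in_subspace[OF subspace[OF g] supp_finite[OF x], of "comp x"] msum_comp[OF x] by simp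
qed

text \<open>The diagonal units have degree \<open>\<one>\<close>, so multiplying \<open>x\<close> by
  them on both sides isolates one entry without changing the degree. The result is a non-zero
  multiple of \<open>munit n i j\<close>, whose degree is prescribed.\<close>

lemma elementary_entry:
  assumes \<gamma>: "\<And>i. i < n \<Longrightarrow> \<gamma> i \<in> carrier G"
    and mu: "\<And>i j. i \<le> j \<Longrightarrow> j < n \<Longrightarrow> munit n i j \<in> \<Gamma> (inv (\<gamma> i) \<otimes> \<gamma> j)"
    and g: "g \<in> carrier G" and x: "x \<in> \<Gamma> g" and ij: "i < n" "j < n" and nz: "x $$ (i, j) \<noteq> 0"
  shows "inv (\<gamma> i) \<otimes> \<gamma> j = g"
proof (rule homogeneous_unique)
  have xUT: "x \<in> UT n" using g x \<Gamma>_UT by blast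
  have xc: "x \<in> carrier_mat n n" using xUT by (rule UT_carrier)
  have le: "i \<le> j" using UT_entry[OF xUT ij(1), of j] nz by (meson not_le)
  show "x $$ (i, j) \<cdot>\<^sub>m munit n i j \<in> \<Gamma> (inv (\<gamma> i) \<otimes> \<gamma> j)"
    using mu[OF le ij(2)] \<gamma>[OF ij(1)] \<gamma>[OF ij(2)] by (intro \<Gamma>_smult) auto
  have one: "munit n k k \<in> \<Gamma> \<one>" if "k < n" for k using mu[of k k] \<gamma>[OF that] that by simp
  have "munit n i i * x * munit n j j \<in> \<Gamma> (\<one> \<otimes> g \<otimes> \<one>)"
    using one ij g x by (intro \<Gamma>_mult) auto
  moreover have "munit n i i * x * munit n j j = x $$ (i, j) \<cdot>\<^sub>m munit n i j"
  proof (rule mat_eqI[of _ n])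
    have ex: "munit n i i * x \<in> carrier_mat n n"
      using xc by (intro mult_carrier_mat[OF munit_carrier])
    fix a b assume ab: "a < n" "b < n"
    show "(munit n i i * x * munit n j j) $$ (a, b) = (x $$ (i, j) \<cdot>\<^sub>m munit n i j) $$ (a, b)"
      unfolding mult_munit_entry[OF ex ij(2) ab] munit_mult_entry[OF xc ij(1) ab(1) ij(2)]
      using ab by (simp add: munit_entry carrier_matD[OF munit_carrier])
  qed (use xc in \<open>auto simp: munit_carrier intro!: mult_carrier_mat\<close>)
  ultimately show "x $$ (i, j) \<cdot>\<^sub>m munit n i j \<in> \<Gamma> g" using g by simp
  show "x $$ (i, j) \<cdot>\<^sub>m munit n i j \<noteq> 0\<^sub>m n n"
  proof
    assume "x $$ (i, j) \<cdot>\<^sub>m munit n i j = 0\<^sub>m n n"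
    from arg_cong[OF this, of "\<lambda>z. z $$ (i, j)"] show False
      using ij nz by (simp add: munit_entry carrier_matD[OF munit_carrier])
  qed
qed (use \<gamma> ij g in auto)

lemma canon_homogeneous_via:
  assumes "elementary n G \<Gamma>" and \<phi>: "antiautomorphism n \<phi>" and hom: "homogeneous_via n G \<Gamma> \<theta> \<phi>"
  shows "homogeneous_via n G \<Gamma> \<theta> (canon n)"
proof -
  obtain \<gamma> where el: "(\<forall>i<n. \<gamma> i \<in> carrier G) \<and>
      (\<forall>i j. i \<le> j \<and> j < n \<longrightarrow> munit n i j \<in> \<Gamma> (inv (\<gamma> i) \<otimes> \<gamma> j))"
    using assms(1) unfolding elementary_def by (rule exE)
  have \<gamma>: "\<gamma> i \<in> carrier G" if "i < n" for i
    using el that by simp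
  have mu: "munit n i j \<in> \<Gamma> (inv (\<gamma> i) \<otimes> \<gamma> j)" if "i \<le> j" "j < n" for i j
    using el that by simp
  define d where "d i j = inv (\<gamma> i) \<otimes> \<gamma> j" for i j
  have entry: "d i j = g"
    if "g \<in> carrier G" "x \<in> \<Gamma> g" "i < n" "j < n" "x $$ (i, j) \<noteq> 0" for g x i j
    unfolding d_def using elementary_entry[of \<gamma>] \<gamma> mu that by blast
  have dS: "d i j \<in> Supp n G \<Gamma>" if "i \<le> j" "j < n" for i j
  proof -
    have "munit n i j \<in> \<Gamma> (d i j)" using mu[OF that] by (simp add: d_def)
    moreover have "munit n i j \<noteq> (0\<^sub>m n n :: 'k mat)" using that by (intro munit_neq_zero) auto
    ultimately show ?thesis using that \<gamma> by (auto simp: Supp_def d_def)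
  qed
  have \<theta>: "\<theta> g \<in> Supp n G \<Gamma>" "g \<in> carrier G" "\<theta> g \<in> carrier G" if "g \<in> Supp n G \<Gamma>" for g
    using hom that by (auto simp: homogeneous_via_def bij_betw_def Supp_def)
  have flip: "d (n - 1 - j) (n - 1 - i) = \<theta> (d i j)" if "i \<le> j" "j < n" for i j
  proof (rule entry)
    show "\<phi> (munit n i j) \<in> \<Gamma> (\<theta> (d i j))"
      using hom dS[OF that] mu[OF that] unfolding homogeneous_via_def d_def by blast
    show "\<phi> (munit n i j) $$ (n - 1 - j, n - 1 - i) \<noteq> 0"
      using \<phi> that by (rule antiautomorphism_munit_entry)
  qed (use that \<theta> dS in auto)
  have "canon n ` \<Gamma> g = \<Gamma> (\<theta> g)" if g: "g \<in> Supp n G \<Gamma>" for g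
  proof (rule antisym; rule subsetI)
    fix y assume "y \<in> canon n ` \<Gamma> g"
    then obtain x where x: "x \<in> \<Gamma> g" "y = canon n x" by blast
    have xUT: "x \<in> UT n" using \<Gamma>_UT[OF \<theta>(2)[OF g] x(1)] .
    show "y \<in> \<Gamma> (\<theta> g)"
    proof (rule mem_of_support[where d = d])
      show "y \<in> UT n" using canon_UT[OF xUT] x by simp
      fix a b assume ab: "a < n" "b < n" "y $$ (a, b) \<noteq> 0"
      then have nz: "x $$ (n - 1 - b, n - 1 - a) \<noteq> 0" by (simp add: x(2) canon_entry)
      then have "d (n - 1 - b) (n - 1 - a) = g"
        using entry[OF \<theta>(2)[OF g] x(1)] ab by auto
      moreover have "n - 1 - b \<le> n - 1 - a"
        using UT_entry[OF xUT, of "n - 1 - b" "n - 1 - a"] nz ab by force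
      ultimately show "d a b = \<theta> g"
        using flip[of "n - 1 - b" "n - 1 - a"] ab by simp
    qed (use entry \<theta> g in auto)
  next
    fix y assume y: "y \<in> \<Gamma> (\<theta> g)"
    have yUT: "y \<in> UT n" using \<Gamma>_UT[OF \<theta>(3)[OF g] y] .
    have cUT: "canon n y \<in> UT n" using canon_UT[OF yUT] .
    have "canon n y \<in> \<Gamma> g"
    proof (rule mem_of_support[where d = d])
      fix a b assume ab: "a < n" "b < n" "canon n y $$ (a, b) \<noteq> 0"
      then have "y $$ (n - 1 - b, n - 1 - a) \<noteq> 0" by (simp add: canon_entry)
      then have *: "d (n - 1 - b) (n - 1 - a) = \<theta> g"
        using entry[OF \<theta>(3)[OF g] y] ab by auto
      have le: "a \<le> b" using UT_entry[OF cUT ab(1), of b] ab(3) by force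
      \<comment> \<open>\<open>flip\<close> only identifies degrees after applying
        \<open>\<theta>\<close>; injectivity of \<open>\<theta>\<close> on the support recovers
        \<open>d a b = g\<close>.\<close>
      then have "\<theta> (d a b) = \<theta> g" using flip[OF le ab(2)] * by simp
      then show "d a b = g"
        using hom dS[OF le ab(2)] g unfolding homogeneous_via_def bij_betw_def inj_on_def by blast
    qed (use entry \<theta> g cUT in auto)
    then show "y \<in> canon n ` \<Gamma> g"
      using canon_canon[OF yUT] by (metis image_eqI)
  qed
  then show ?thesis using hom by (simp add: homogeneous_via_def)
qed

text \<open>\<open>elementary_support\<close> says where homogeneous elements can be non-zero;
  \<open>mem_of_support\<close> converts this into membership of the matrix units, each of which
  occupies a single position.\<close>

lemma isomorphic_elementary:
  "\<exists>\<Gamma>'. is_grading n G \<Gamma>' \<and> graded_isomorphic n G \<Gamma> \<Gamma>' \<and> elementary n G \<Gamma>'"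
proof -
  obtain \<alpha> \<gamma> where \<alpha>: "automorphism n \<alpha>" and \<gamma>: "\<And>i. i < n \<Longrightarrow> \<gamma> i \<in> carrier G"
    and supp: "\<And>g x i j. g \<in> carrier G \<Longrightarrow> x \<in> \<Gamma> g \<Longrightarrow> i < n \<Longrightarrow> j < n \<Longrightarrow> \<alpha> x $$ (i, j) \<noteq> 0
      \<Longrightarrow> inv (\<gamma> i) \<otimes> \<gamma> j = g"
    using elementary_support by blast
  let ?\<Gamma>' = "\<lambda>g. \<alpha> ` \<Gamma> g"
  have \<Gamma>': "is_grading n G ?\<Gamma>'" using is_grading_image[OF \<alpha> grading] .
  interpret \<Gamma>': UT_grading G n ?\<Gamma>' by unfold_locales (rule \<Gamma>')
  have "munit n i j \<in> ?\<Gamma>' (inv (\<gamma> i) \<otimes> \<gamma> j)" if "i \<le> j" "j < n" for i j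
    using supp that \<gamma> munit_UT[OF that(1)]
    by (intro \<Gamma>'.mem_of_support[where d = "\<lambda>i j. inv (\<gamma> i) \<otimes> \<gamma> j"]) (auto simp: munit_entry split: if_splits)
  then show ?thesis
    using \<alpha> \<gamma> \<Gamma>' unfolding elementary_def graded_isomorphic_def by blast
qed

end

text \<open>Homogeneity of \<open>canon n\<close> is not invariant under graded isomorphism. For
  \<open>n = 2\<close>, take the diagonal matrices and the span of \<open>munit 2 0 1\<close> as the
  components of two distinct degrees: conjugation by 1 + t \<open>munit 2 0 1\<close> with t
  non-zero gives a grading for which \<open>canon 2\<close> is not homogeneous, as the
  characteristic is not 2. Existence is therefore compared with \<open>canon n\<close> on the
  elementary gradings isomorphic to \<open>\<Gamma>\<close>; the last conjunct treats
  \<open>\<Gamma>\<close> itself.\<close>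

theorem corollary3p4:
  fixes G :: "('g, 'b) monoid_scheme"
    and n :: nat
    and \<Gamma> :: "'g \<Rightarrow> 'k::field mat set"
  assumes "CHAR('k) \<noteq> 2"
    and "group G"
    and "n \<ge> 1"
    and "is_grading n G \<Gamma>"
  shows "(\<exists>\<Gamma>'. is_grading n G \<Gamma>' \<and> graded_isomorphic n G \<Gamma> \<Gamma>' \<and> elementary n G \<Gamma>')
    \<and> (\<forall>\<Gamma>'. is_grading n G \<Gamma>' \<and> graded_isomorphic n G \<Gamma> \<Gamma>' \<and> elementary n G \<Gamma>' \<longrightarrow>
         ((\<exists>\<phi>. antiautomorphism n \<phi> \<and> homogeneous n G \<Gamma> \<phi>) \<longleftrightarrow>
            homogeneous n G \<Gamma>' (canon n)) \<and>
         (\<forall>\<phi>. involution n \<phi> \<and> homogeneous n G \<Gamma>' \<phi> \<longrightarrow>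
            (\<exists>\<psi>. graded_automorphism n G \<Gamma>' \<psi> \<and> (\<forall>x\<in>UT n. \<phi> x = canon n (\<psi> x)))))
    \<and> (homogeneous n G \<Gamma> (canon n) \<longrightarrow>
         (\<forall>\<phi>. involution n \<phi> \<and> homogeneous n G \<Gamma> \<phi> \<longrightarrow>
            (\<exists>\<psi>. graded_automorphism n G \<Gamma> \<psi> \<and> (\<forall>x\<in>UT n. \<phi> x = canon n (\<psi> x)))))"
proof -
  have loc: "UT_grading G n \<Delta>" if "is_grading n G \<Delta>" for \<Delta> :: "'g \<Rightarrow> 'k mat set"
    using assms(2) that by (simp add: UT_grading_def UT_grading_axioms_def)
  have UT: "\<Delta> g \<subseteq> UT n" if "is_grading n G \<Delta>" "g \<in> carrier G" for \<Delta> :: "'g \<Rightarrow> 'k mat set" and g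
    using that by (simp add: is_grading_def UT_subspace_def)
  note \<Gamma> = UT[OF assms(4)]
  have ex: "\<exists>\<Gamma>'. is_grading n G \<Gamma>' \<and> graded_isomorphic n G \<Gamma> \<Gamma>' \<and> elementary n G \<Gamma>'"
    by (rule UT_grading.isomorphic_elementary[OF loc[OF assms(4)]])
  have canon_via: "homogeneous_via n G \<Gamma>' \<theta> (canon n)"
    if \<Gamma>': "is_grading n G \<Gamma>'" "elementary n G \<Gamma>'"
      and \<alpha>: "automorphism n \<alpha>" "\<And>g. g \<in> carrier G \<Longrightarrow> \<alpha> ` \<Gamma> g = \<Gamma>' g"
      and \<phi>: "antiautomorphism n \<phi>" "homogeneous_via n G \<Gamma> \<theta> \<phi>" for \<Gamma>' \<alpha> \<phi> \<theta>
    using UT_grading.canon_homogeneous_via[OF loc[OF \<Gamma>'(1)] \<Gamma>'(2)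
        antiautomorphism_conj[OF \<alpha>(1) \<phi>(1) automorphism_inverse(1)[OF \<alpha>(1)]]
        homogeneous_via_conj[OF \<alpha>(1) \<Gamma> \<alpha>(2) \<phi>(2)]] .
  have second: "((\<exists>\<phi>. antiautomorphism n \<phi> \<and> homogeneous n G \<Gamma> \<phi>) \<longleftrightarrow> homogeneous n G \<Gamma>' (canon n)) \<and>
      (\<forall>\<phi>. involution n \<phi> \<and> homogeneous n G \<Gamma>' \<phi> \<longrightarrow>
        (\<exists>\<psi>. graded_automorphism n G \<Gamma>' \<psi> \<and> (\<forall>x\<in>UT n. \<phi> x = canon n (\<psi> x))))"
    if gr: "is_grading n G \<Gamma>'" and iso: "graded_isomorphic n G \<Gamma> \<Gamma>'" and el: "elementary n G \<Gamma>'" for \<Gamma>'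
  proof (intro conjI iffI allI impI)
    obtain \<alpha> where \<alpha>: "automorphism n \<alpha>" "\<And>g. g \<in> carrier G \<Longrightarrow> \<alpha> ` \<Gamma> g = \<Gamma>' g"
      using iso unfolding graded_isomorphic_def by blast
    show "homogeneous n G \<Gamma>' (canon n)" if "\<exists>\<phi>. antiautomorphism n \<phi> \<and> homogeneous n G \<Gamma> \<phi>"
      using that canon_via[OF gr el \<alpha>] unfolding homogeneous_iff by blast
    show "\<exists>\<phi>. antiautomorphism n \<phi> \<and> homogeneous n G \<Gamma> \<phi>" if hom: "homogeneous n G \<Gamma>' (canon n)"
    proof -
      let ?\<beta> = "inv_into (UT n) \<alpha>"
      obtain \<theta> where \<theta>: "homogeneous_via n G \<Gamma>' \<theta> (canon n)" using hom unfolding homogeneous_iff by blast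
      have \<beta>: "automorphism n ?\<beta>" using automorphism_inverse(1)[OF \<alpha>(1)] .
      have "?\<beta> ` \<Gamma>' g = \<Gamma> g" if "g \<in> carrier G" for g
        using inv_into_image[OF \<alpha>(1) \<Gamma>[OF that]] \<alpha>(2)[OF that] by simp
      \<comment> \<open>The witness is \<open>canon n\<close> conjugated back to
        \<open>\<Gamma>\<close>; \<open>inv_into (UT n) ?\<beta>\<close> agrees with
        \<open>\<alpha>\<close> on \<open>UT n\<close>.\<close>
      then have "homogeneous_via n G \<Gamma> \<theta> (?\<beta> \<circ> canon n \<circ> inv_into (UT n) ?\<beta>)"
        using \<theta> by (intro homogeneous_via_conj[OF \<beta> UT[OF gr]])
      then show ?thesis
        using antiautomorphism_conj[OF \<beta> canon_antiautomorphism automorphism_inverse(1)[OF \<beta>]]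
        unfolding homogeneous_iff by blast
    qed
    fix \<phi> assume "involution n \<phi> \<and> homogeneous n G \<Gamma>' \<phi>"
    then obtain \<theta> where \<phi>: "antiautomorphism n \<phi>" "homogeneous_via n G \<Gamma>' \<theta> \<phi>"
      unfolding involution_def homogeneous_iff by blast
    show "\<exists>\<psi>. graded_automorphism n G \<Gamma>' \<psi> \<and> (\<forall>x\<in>UT n. \<phi> x = canon n (\<psi> x))"
      using UT_grading.canon_homogeneous_via[OF loc[OF gr] el \<phi>] UT[OF gr] \<phi>
      by (intro canon_comp_graded_automorphism) auto
  qed
  have third: "\<exists>\<psi>. graded_automorphism n G \<Gamma> \<psi> \<and> (\<forall>x\<in>UT n. \<phi> x = canon n (\<psi> x))"
    if canon: "homogeneous n G \<Gamma> (canon n)" and inv: "involution n \<phi> \<and> homogeneous n G \<Gamma> \<phi>" for \<phi>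
  proof -
    obtain \<theta> where \<phi>: "antiautomorphism n \<phi>" "homogeneous_via n G \<Gamma> \<theta> \<phi>"
      using inv unfolding involution_def homogeneous_iff by blast
    obtain \<eta> where \<eta>: "homogeneous_via n G \<Gamma> \<eta> (canon n)"
      using canon unfolding homogeneous_iff by blast
    obtain \<Gamma>' \<alpha> where gr: "is_grading n G \<Gamma>'" "elementary n G \<Gamma>'"
      and \<alpha>: "automorphism n \<alpha>" "\<And>g. g \<in> carrier G \<Longrightarrow> \<alpha> ` \<Gamma> g = \<Gamma>' g"
      using ex unfolding graded_isomorphic_def by blast
    \<comment> \<open>A priori \<open>canon n\<close> and \<open>\<phi>\<close> permute the
      components differently. After transport to the elementary \<open>\<Gamma>'\<close>, each of
      them forces \<open>canon n\<close> to induce its own permutation there, so the target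
      components coincide.\<close>
    have "\<Gamma> (\<eta> g) = \<Gamma> (\<theta> g)" if g: "g \<in> Supp n G \<Gamma>" for g
    proof -
      have car: "\<eta> g \<in> carrier G" "\<theta> g \<in> carrier G"
        using homogeneous_via_Supp[OF \<eta> g] homogeneous_via_Supp[OF \<phi>(2) g] by (simp_all add: Supp_def)
      have "g \<in> Supp n G \<Gamma>'"
        using Supp_image[where G = G and \<Gamma> = \<Gamma> and \<Gamma>' = \<Gamma>', OF \<alpha>(1) \<Gamma> \<alpha>(2)] g by simp
      then have "\<Gamma>' (\<eta> g) = \<Gamma>' (\<theta> g)"
        using canon_via[OF gr \<alpha> \<phi>] canon_via[OF gr \<alpha> canon_antiautomorphism \<eta>]
          g unfolding homogeneous_via_def by metis
      then show ?thesis
        using inv_into_image[OF \<alpha>(1) \<Gamma>[OF car(1)]] inv_into_image[OF \<alpha>(1) \<Gamma>[OF car(2)]]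
          \<alpha>(2) car by simp
    qed
    then have "homogeneous_via n G \<Gamma> \<theta> (canon n)"
      using \<eta> \<phi>(2) by (simp add: homogeneous_via_def)
    then show ?thesis
      using \<phi> \<Gamma> by (intro canon_comp_graded_automorphism) auto
  qed
  show ?thesis using ex second third by blast
qed

end
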